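(* Let $n$ be a positive integer and let $\mathbb B$ be the open Euclidean unit ball in $\mathbb R^n$. For a matrix $A\in\mathbb R^{n\times n}$ the following are equivalent: (i) there exists a harmonic map $f\colon\mathbb B\to\mathbb B$ with $f(0)=0$ and $Df(0)=A$; (ii) there exists a harmonic map $f\colon\mathbb B\to\mathbb B$ with $Df(0)=A$; (iii) $\|A\|_{H^1_*}\le 1$.
   Context: A map $f\colon\mathbb B\to\mathbb B$ is harmonic if each of its $n$ real components is a harmonic function on $\mathbb B$; $Df(0)$ is its Jacobian matrix at $0$. Let $\mathbb S=\partial\mathbb B$ be the unit sphere and $\mu$ the normalized surface measure on $\mathbb S$ (total mass $1$). For $B\in\mathbb R^{n\times n}$ the Hardy norm is $\|B\|_{H^1}=\int_{\mathbb S}\|Bx\|\,d\mu(x)$, where $\|Bx\|$ is the Euclidean norm. The inner product on $\mathbb R^{n\times n}$ is $\langle A,B\rangle=\frac1n\operatorname{tr}(B^TA)$, and the dual norm is $\|A\|_{H^1_*}=\sup\{\langle A,B\rangle : B\in\mathbb R^{n\times n},\ \|B\|_{H^1}\le 1\}$. *)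

theory Defs
  imports "HOL-Analysis.Analysis"
begin

(* g is the gradient and H x the Hessian (as a linear map) of u at x, so that
   u is twice continuously differentiable, and the trace of H x is the Laplacian. *)
definition harmonic_on :: "('a::euclidean_space \<Rightarrow> real) \<Rightarrow> 'a set \<Rightarrow> bool" where
  "harmonic_on u S \<longleftrightarrow> open S \<and>
     (\<exists>g H. (\<forall>x\<in>S. (u has_derivative (\<lambda>h. g x \<bullet> h)) (at x) \<and> (g has_derivative H x) (at x)) \<and>
            (\<forall>b\<in>Basis. continuous_on S (\<lambda>x. H x b)) \<and>
            (\<forall>x\<in>S. (\<Sum>b\<in>Basis. H x b \<bullet> b) = 0))"

(* The values of f outside the open ball are irrelevant. *)
definition harmonic_self_map_ball :: "(real^'n \<Rightarrow> real^'n) \<Rightarrow> bool" where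
  "harmonic_self_map_ball f \<longleftrightarrow>
     f ` ball 0 1 \<subseteq> ball 0 1 \<and> (\<forall>i. harmonic_on (\<lambda>x. f x $ i) (ball 0 1))"

(* Normalized surface measure, as the cone measure: the measure of a Borel set E of unit
   vectors is the share of the unit ball filled by the rays from 0 through E
   (recall that sgn x = x / norm x). It lives on the Borel sets of the sphere. *)
definition sphere_measure :: "'a::euclidean_space measure" where
  "sphere_measure =
     restrict_space (distr (uniform_measure lborel (ball 0 1)) borel sgn) (sphere 0 1)"

lemma emeasure_sphere_measure:
  fixes E :: "'a::euclidean_space set"
  assumes "E \<in> sets borel" "E \<subseteq> sphere 0 1"
  shows "emeasure sphere_measure E =
    emeasure lborel {t *\<^sub>R x | t x. 0 < t \<and> t < 1 \<and> x \<in> E} / emeasure lborel (ball (0::'a) 1)"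
proof -
  have sg: "sgn -` E \<in> sets (borel :: 'a measure)"
    using measurable_sets[OF borel_measurable_sgn assms(1)] by simp
  have "ball 0 1 \<inter> sgn -` E = {t *\<^sub>R x | t x. 0 < t \<and> t < 1 \<and> x \<in> E}" (is "?L = ?R")
  proof
    show "?L \<subseteq> ?R"
    proof
      fix y assume y: "y \<in> ?L"
      then have "sgn y \<in> E" by simp
      moreover from this assms(2) have "y \<noteq> 0" by (auto simp: sgn_zero_iff)
      ultimately have "y = norm y *\<^sub>R sgn y \<and> 0 < norm y \<and> norm y < 1 \<and> sgn y \<in> E"
        using y by (simp add: sgn_div_norm)
      then show "y \<in> ?R" by blast
    qed
    show "?R \<subseteq> ?L"
      using assms(2) by (auto simp: sgn_scaleR sgn_div_norm subset_iff)
  qed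
  moreover have "emeasure sphere_measure E = emeasure (uniform_measure lborel (ball 0 1)) (sgn -` E)"
    using assms unfolding sphere_measure_def
    by (subst emeasure_restrict_space) (auto simp: emeasure_distr)
  ultimately show ?thesis
    using sg by (simp add: emeasure_uniform_measure)
qed

lemma emeasure_sphere_measure_total:
  "emeasure sphere_measure (sphere (0::'a::euclidean_space) 1) = 1"
proof -
  have "emeasure sphere_measure (sphere (0::'a) 1) =
      emeasure (uniform_measure lborel (ball (0::'a) 1)) (sgn -` sphere 0 1)"
    unfolding sphere_measure_def
    by (subst emeasure_restrict_space) (auto simp: emeasure_distr)
  also have "sgn -` sphere 0 1 = UNIV - {0::'a}"
    by (auto simp: norm_sgn)
  also have "emeasure (uniform_measure lborel (ball (0::'a) 1)) (UNIV - {0}) =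
      emeasure lborel (ball (0::'a) 1 - {0}) / emeasure lborel (ball (0::'a) 1)"
    by (subst emeasure_uniform_measure) (auto intro!: arg_cong2[where f="(/)"] arg_cong[where f="emeasure lborel"])
  also have "emeasure lborel (ball (0::'a) 1 - {0}) = emeasure lborel (ball (0::'a) 1)"
    by (rule emeasure_Diff_null_set) auto
  also have "emeasure lborel (ball (0::'a) 1) / emeasure lborel (ball (0::'a) 1) = 1"
    using emeasure_lborel_ball_finite[of "0::'a" 1] less_imp_neq[OF unit_ball_vol_pos[of "real DIM('a)"]]
    by (intro ennreal_divide_self) (auto simp: emeasure_ball simp del: unit_ball_vol_pos)
  finally show ?thesis .
qed

definition hardy_norm :: "real^'n^'n \<Rightarrow> real" where
  "hardy_norm B = (\<integral>x. norm (B *v x) \<partial>sphere_measure)"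

definition matrix_inner :: "real^'n^'n \<Rightarrow> real^'n^'n \<Rightarrow> real" where
  "matrix_inner A B = trace (transpose B ** A) / real CARD('n)"

definition hardy_dual_norm :: "real^'n^'n \<Rightarrow> real" where
  "hardy_dual_norm A = Sup {matrix_inner A B | B. hardy_norm B \<le> 1}"

end

theory Submission
  imports Defs
begin

text \<open>
  (ii) to (iii): the divergence theorem applied on the unit ball to \<open>x \<mapsto> (x \<bullet> c) \<nabla>u(r x)\<close> and to
  \<open>x \<mapsto> u(r x) c\<close> shows that \<open>L(r) = \<integral> u(r z) (z \<bullet> c) d\<mu>(z)\<close> satisfies \<open>r L' = L\<close>, hence
  \<open>L(r) = r (\<nabla>u(0) \<bullet> c) / n\<close>. Summing over the components of \<open>f\<close> gives
  \<open>r \<langle>A, B\<rangle> = \<integral> f(r z) \<bullet> B z d\<mu> \<le> \<parallel>B\<parallel>\<close>, and \<open>r\<close> tends to 1.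

  (iii) to (i): no Hahn-Banach extension is needed. Let \<open>B\<close> maximise \<open>\<langle>A, B\<rangle> / \<parallel>B\<parallel>\<close>, with
  maximum \<open>t \<le> 1\<close>. As \<open>B z \<noteq> 0\<close> almost everywhere, the Hardy norm is differentiable at \<open>B\<close>, and the
  first-order condition reads \<open>\<langle>A, C\<rangle> = t \<integral> sgn (B z) \<bullet> C z d\<mu>\<close> for all \<open>C\<close>. This says that
  \<open>t\<close> times the Poisson integral of the odd map \<open>z \<mapsto> sgn (B z)\<close> has derivative \<open>A\<close> at 0.
\<close>

section \<open>Integration over the sphere\<close>

text \<open>The sphere measure is given through rays, so surface integrals have to be produced as
  limits of volume integrals over thin shells. The divergence theorem is built that way, and both
  the mean value property and the first moment of a harmonic function are drawn from it. The
  dimension \<open>n\<close> enters as \<open>1 / n\<close> in the first moment, as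
  \<open>1 / n\<close> in the matrix inner product, and as the factor in the gradient
  \<open>n z\<close> of the Poisson kernel at 0. These factors match, so no constant is lost in
  either direction. The target of the maps is the open ball, whereas the Poisson integral of a field
  of norm at most 1 is a priori only bounded by 1. Oddness of \<open>sgn (B z)\<close> resolves
  this: a field of mean zero permits subtracting a positive constant from the kernel. The same mean
  is the value at the origin, so the map constructed satisfies the normalisation in (i). The
  extremal \<open>B\<close> may be singular; it is nonzero, and then its kernel meets the sphere in
  a null set. For \<open>A = 0\<close> the maximum is \<open>t = 0\<close> and the argument is
  unchanged.\<close>

lemma space_sphere_measure [simp]: "space (sphere_measure :: 'a::euclidean_space measure) = sphere 0 1"
  by (simp add: sphere_measure_def space_restrict_space)

lemma sets_sphere_measure:
  "sets (sphere_measure :: 'a::euclidean_space measure) = sets (restrict_space borel (sphere 0 1))"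
  unfolding sphere_measure_def by (rule sets_restrict_space_cong) simp

interpretation sphere_measure: finite_measure "sphere_measure :: 'a::euclidean_space measure"
  by (rule finite_measureI) (simp add: emeasure_sphere_measure_total)

lemma measure_sphere_measure [simp]: "measure sphere_measure (sphere (0::'a::euclidean_space) 1) = 1"
  by (simp add: measure_def emeasure_sphere_measure_total)

lemma borel_measurable_sphere_continuous:
  fixes h :: "'a::euclidean_space \<Rightarrow> 'b::topological_space"
  assumes "continuous_on (sphere 0 1) h"
  shows "h \<in> borel_measurable sphere_measure"
  using borel_measurable_continuous_on_restrict[OF assms]
  by (simp cong: measurable_cong_sets add: sets_sphere_measure)

lemma borel_measurable_sphere:
  fixes h :: "'a::euclidean_space \<Rightarrow> 'b::topological_space"
  assumes "h \<in> borel_measurable borel"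
  shows "h \<in> borel_measurable sphere_measure"
  using measurable_restrict_space1[OF assms]
  by (simp cong: measurable_cong_sets add: sets_sphere_measure)

lemma integrable_sphere_bounded:
  fixes h :: "'a::euclidean_space \<Rightarrow> 'b::{banach, second_countable_topology}"
  assumes "h \<in> borel_measurable sphere_measure" "\<And>z. norm z = 1 \<Longrightarrow> norm (h z) \<le> C"
  shows "integrable sphere_measure h"
  using assms by (intro sphere_measure.integrable_const_bound[of _ C]) (auto intro!: AE_I2)

lemma integrable_sphere_continuous:
  fixes h :: "'a::euclidean_space \<Rightarrow> 'b::{banach, second_countable_topology}"
  assumes "continuous_on (sphere 0 1) h"
  shows "integrable sphere_measure h"
proof -
  have "bounded (h ` sphere 0 1)"
    using assms by (intro compact_imp_bounded compact_continuous_image) auto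
  then obtain C where "\<And>z. norm z = 1 \<Longrightarrow> norm (h z) \<le> C"
    unfolding bounded_iff by force
  then show ?thesis
    using assms by (intro integrable_sphere_bounded borel_measurable_sphere_continuous)
qed

lemma measure_unit_ball_pos: "measure lborel (ball (0::'a::euclidean_space) 1) > 0"
  using content_ball_pos[of 1 "0::'a"] by simp

text \<open>The cone measure is the image of Lebesgue measure on the ball under \<open>sgn\<close>,
  so null sets of the sphere can be tested in the ambient space. The origin is exempted because
  \<open>sgn 0 = 0\<close> is not a unit vector.\<close>

lemma AE_sphere_measureI:
  assumes "AE x in lborel. x \<noteq> 0 \<longrightarrow> P (sgn x :: 'a::euclidean_space)" "Measurable.pred borel P"
  shows "AE z in sphere_measure. P z"
  unfolding sphere_measure_def
  using assms
  by (subst AE_restrict_space_iff) 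
    (auto simp: AE_distr_iff norm_sgn intro!: AE_uniform_measureI elim!: eventually_mono split: if_splits)

text \<open>Off the origin \<open>sgn\<close> lands on the sphere, where \<open>h\<close> agrees
  with its cut-off by an indicator, a Borel function on the whole space. The single point at which
  \<open>sgn\<close> leaves the sphere is patched by a case distinction.\<close>

lemma borel_measurable_compose_sgn:
  fixes h :: "'a::euclidean_space \<Rightarrow> 'b::{banach, second_countable_topology}"
  assumes h: "h \<in> borel_measurable sphere_measure"
  shows "(\<lambda>x. h (sgn x)) \<in> borel_measurable borel"
proof -
  have hm: "(\<lambda>z. indicator (sphere 0 1) z *\<^sub>R h z) \<in> borel_measurable borel"
    using h by (subst (asm) measurable_cong_sets[OF sets_sphere_measure refl])
       (simp add: borel_measurable_restrict_space_iff)
  have "(\<lambda>x. if x = 0 then h 0 else indicator (sphere 0 1) (sgn x) *\<^sub>R h (sgn x)) \<in> borel_measurable borel"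
    using measurable_compose[OF borel_measurable_sgn hm] by measurable
  also have "(\<lambda>x. if x = 0 then h 0 else indicator (sphere 0 1) (sgn x) *\<^sub>R h (sgn x)) = (\<lambda>x. h (sgn x))"
    by (auto simp: fun_eq_iff indicator_def norm_sgn)
  finally show ?thesis .
qed

text \<open>The bridge to Lebesgue measure: integrals over the sphere are integrals over the ball of
  functions that are constant along rays. All properties of the sphere measure used later pass
  through it or through the corresponding statement on null sets.\<close>

lemma integral_sphere_measure:
  fixes h :: "'a::euclidean_space \<Rightarrow> 'b::{banach, second_countable_topology}"
  assumes h: "h \<in> borel_measurable sphere_measure"
  shows "(LINT x:ball 0 1|lborel. h (sgn x)) = measure lborel (ball (0::'a) 1) *\<^sub>R (\<integral>z. h z \<partial>sphere_measure)"
proof -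
  let ?V = "measure lborel (ball (0::'a) 1)"
  let ?h = "\<lambda>z. indicator (sphere 0 1) z *\<^sub>R h z"
  have hm: "?h \<in> borel_measurable borel"
    using h by (subst (asm) measurable_cong_sets[OF sets_sphere_measure refl])
       (simp add: borel_measurable_restrict_space_iff)
  have V: "emeasure lborel (ball (0::'a) 1) = ennreal ?V"
    using emeasure_lborel_ball_finite[of "0::'a" 1] by (simp add: emeasure_eq_ennreal_measure)
  have dens: "uniform_measure lborel (ball (0::'a) 1) = density lborel (\<lambda>x. ennreal (indicator (ball 0 1) x / ?V))"
    unfolding uniform_measure_def V
    using measure_unit_ball_pos[where 'a='a]
    by (intro arg_cong[where f="density lborel"]) (auto simp: fun_eq_iff indicator_def divide_ennreal simp flip: ennreal_1)
  have "(\<integral>z. h z \<partial>sphere_measure) = (\<integral>x. ?h x \<partial>distr (uniform_measure lborel (ball 0 1)) borel sgn)"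
    unfolding sphere_measure_def by (subst integral_restrict_space) auto
  also have "\<dots> = (\<integral>x. ?h (sgn x) \<partial>uniform_measure lborel (ball 0 1))"
    using hm by (subst integral_distr) auto
  also have "\<dots> = (\<integral>x. (indicator (ball 0 1) x / ?V) *\<^sub>R ?h (sgn x) \<partial>lborel)"
    unfolding dens using measurable_compose[OF borel_measurable_sgn hm]
    by (intro integral_density)
       (auto simp: measure_unit_ball_pos less_imp_le intro!: borel_measurable_divide borel_measurable_indicator)
  also have "\<dots> = (\<integral>x. inverse ?V *\<^sub>R (indicator (ball 0 1) x *\<^sub>R ?h (sgn x)) \<partial>lborel)"
    by (simp add: divide_inverse ac_simps)
  also have "\<dots> = inverse ?V *\<^sub>R (\<integral>x. indicator (ball 0 1) x *\<^sub>R ?h (sgn x) \<partial>lborel)"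
    by (rule integral_scaleR_right) 
  also have "(\<integral>x. indicator (ball 0 1) x *\<^sub>R ?h (sgn x) \<partial>lborel) = (LINT x:ball 0 1|lborel. h (sgn x))"
    unfolding set_lebesgue_integral_def
  proof (rule integral_cong_AE)
    have "(\<lambda>x. ?h (sgn x)) \<in> borel_measurable lborel"
      using measurable_compose[OF borel_measurable_sgn hm] by (simp only: measurable_lborel1 measurable_lborel2)
    from borel_measurable_scaleR[OF borel_measurable_indicator this, of "ball 0 1"]
    show "(\<lambda>x. indicator (ball 0 1) x *\<^sub>R ?h (sgn x)) \<in> borel_measurable lborel"
      by simp
    have "(\<lambda>x. h (sgn x)) \<in> borel_measurable lborel"
      using borel_measurable_compose_sgn[OF h] by simp
    then show "(\<lambda>x. indicator (ball 0 1) x *\<^sub>R h (sgn x)) \<in> borel_measurable lborel"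
      by (intro borel_measurable_scaleR borel_measurable_indicator) auto
    have "AE x in lborel. x \<noteq> (0::'a)" by (rule AE_lborel_singleton)
    then show "AE x in lborel. indicator (ball 0 1) x *\<^sub>R ?h (sgn x) = indicator (ball (0::'a) 1) x *\<^sub>R h (sgn x)"
      by eventually_elim (auto simp: indicator_def norm_sgn)
  qed
  finally show ?thesis
    using measure_unit_ball_pos[where 'a='a] by simp
qed

section \<open>Scaling, translation and reflection\<close>

lemma lborel_integral_scale:
  fixes f :: "'a::euclidean_space \<Rightarrow> 'b::{banach, second_countable_topology}"
  assumes f: "f \<in> borel_measurable borel" and t: "t \<noteq> 0"
  shows "(\<integral>x. f x \<partial>lborel) = \<bar>t\<bar> ^ DIM('a) *\<^sub>R (\<integral>x. f (t *\<^sub>R x) \<partial>lborel)"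
proof -
  have "(\<integral>x. f x \<partial>lborel) = (\<integral>x. f x \<partial>density (distr lborel borel (\<lambda>x. 0 + t *\<^sub>R x)) (\<lambda>_. \<bar>t\<bar> ^ DIM('a)))"
    using lborel_affine[OF t, of "0::'a"] by simp
  also have "\<dots> = (\<integral>x. \<bar>t\<bar> ^ DIM('a) *\<^sub>R f x \<partial>distr lborel borel (\<lambda>x. 0 + t *\<^sub>R x))"
    using f by (subst integral_density) auto
  also have "\<dots> = (\<integral>x. \<bar>t\<bar> ^ DIM('a) *\<^sub>R f (t *\<^sub>R x) \<partial>lborel)"
    using f by (subst integral_distr) auto
  finally show ?thesis by simp
qed

lemma lborel_integral_translate:
  fixes f :: "'a::euclidean_space \<Rightarrow> 'b::{banach, second_countable_topology}"
  assumes f: "f \<in> borel_measurable borel"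
  shows "(\<integral>x. f (a + x) \<partial>lborel) = (\<integral>x. f x \<partial>lborel)"
proof -
  have "(\<integral>x. f x \<partial>lborel) = (\<integral>x. f x \<partial>distr lborel borel ((+) a))"
    by (simp add: lborel_distr_plus)
  also have "\<dots> = (\<integral>x. f (a + x) \<partial>lborel)"
    using f by (subst integral_distr) auto
  finally show ?thesis ..
qed

text \<open>Reflection in the origin preserves Lebesgue measure and commutes with
  \<open>sgn\<close>, so it is the scaling rule with factor -1.\<close>

lemma integral_sphere_uminus:
  fixes h :: "'a::euclidean_space \<Rightarrow> 'b::{banach, second_countable_topology}"
  assumes h: "h \<in> borel_measurable borel"
  shows "(\<integral>z. h (- z) \<partial>sphere_measure) = (\<integral>z. h z \<partial>sphere_measure)"
proof -
  have m: "h \<in> borel_measurable sphere_measure" "(\<lambda>z. h (- z)) \<in> borel_measurable sphere_measure"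
    using h by (auto intro!: borel_measurable_sphere)
  have "(LINT x:ball 0 1|lborel. h (- sgn x)) = (LINT x:ball 0 1|lborel. h (sgn x))"
    unfolding set_lebesgue_integral_def
    using borel_measurable_compose_sgn[OF m(1)]
    by (subst (2) lborel_integral_scale[of _ "-1"]) (auto simp: sgn_minus indicator_def)
  then show ?thesis
    using integral_sphere_measure[OF m(1)] integral_sphere_measure[OF m(2)] measure_unit_ball_pos[where 'a='a]
    by simp
qed

lemma integral_sphere_odd:
  fixes F :: "'a::euclidean_space \<Rightarrow> 'b::{banach, second_countable_topology}"
  assumes F: "F \<in> borel_measurable borel" and odd: "\<And>z. F (- z) = - F z"
  shows "(\<integral>z. F z \<partial>sphere_measure) = 0"
proof -
  have "- (\<integral>z. F z \<partial>sphere_measure) = (\<integral>z. F z \<partial>sphere_measure)"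
    using integral_sphere_uminus[OF F] odd by simp
  then have "2 *\<^sub>R (\<integral>z. F z \<partial>sphere_measure) = 0"
    by (metis add.right_inverse scaleR_2)
  then show ?thesis by simp
qed

text \<open>A function constant along rays scales like volume. This gives the shell between the
  radii \<open>1 - \<delta>\<close> and 1 the explicit weight
  \<open>1 - (1 - \<delta>) ^ n\<close>.\<close>

lemma set_integral_ball_compose_sgn:
  fixes h :: "'a::euclidean_space \<Rightarrow> 'b::{banach, second_countable_topology}"
  assumes h: "h \<in> borel_measurable sphere_measure" and t: "0 < t"
  shows "(LINT x:ball 0 t|lborel. h (sgn x)) = t ^ DIM('a) *\<^sub>R (LINT x:ball 0 1|lborel. h (sgn x))"
proof -
  have "(\<integral>x. indicator (ball 0 t) x *\<^sub>R h (sgn x) \<partial>lborel)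
      = \<bar>t\<bar> ^ DIM('a) *\<^sub>R (\<integral>x. indicator (ball 0 t) (t *\<^sub>R x) *\<^sub>R h (sgn (t *\<^sub>R x)) \<partial>lborel)"
    using t by (intro lborel_integral_scale borel_measurable_scaleR borel_measurable_indicator
        borel_measurable_compose_sgn[OF h]) auto
  also have "(\<lambda>x. indicator (ball 0 t) (t *\<^sub>R x) *\<^sub>R h (sgn (t *\<^sub>R x))) = (\<lambda>x. indicator (ball 0 1) x *\<^sub>R h (sgn x))"
    using t by (auto simp: fun_eq_iff indicator_def sgn_scaleR)
  finally show ?thesis
    using t by (simp add: set_lebesgue_integral_def)
qed

section \<open>The divergence theorem on the unit ball\<close>

text \<open>
  Since \<open>\<phi>\<close> need only be differentiable almost everywhere, the piecewise linear \<open>radial_cutoff\<close>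
  below is admissible. Its gradient lives on a thin shell, which in the limit becomes the sphere.
\<close>

lemma integral_directional_derivative_eq_0:
  fixes \<phi> \<psi> :: "'a::euclidean_space \<Rightarrow> real"
  assumes lip: "L-lipschitz_on UNIV \<phi>"
    and supp: "\<And>x. norm x \<ge> 1 \<Longrightarrow> \<phi> x = 0"
    and \<psi>: "\<psi> \<in> borel_measurable borel"
    and deriv: "AE x in lborel. ((\<lambda>t. \<phi> (x + t *\<^sub>R b)) has_real_derivative \<psi> x) (at 0)"
    and b: "norm b = 1"
  shows "(\<integral>x. \<psi> x \<partial>lborel) = 0"
proof -
  define t :: "nat \<Rightarrow> real" where "t = (\<lambda>k. inverse (real (Suc k)))"
  have t: "0 < t k" "t k \<le> 1" for k by (auto simp: t_def field_simps)
  have t0: "t \<longlonglongrightarrow> 0" unfolding t_def by (rule LIMSEQ_inverse_real_of_nat)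
  have cont: "continuous_on UNIV \<phi>"
    using lip by (rule lipschitz_on_continuous_on)
  then have \<phi>[measurable]: "\<phi> \<in> borel_measurable borel"
    by (rule borel_measurable_continuous_onI)
  have bound: "\<bar>\<phi> (x + t k *\<^sub>R b) - \<phi> x\<bar> \<le> L * t k" for x k
    using lipschitz_onD[OF lip, of "x + t k *\<^sub>R b" x] b t[of k] by (simp add: dist_norm)
  \<comment> \<open>Radius 2 is support radius 1 plus the largest step 1: beyond it neither end of
    the difference quotient meets the support.\<close>
  have far: "norm (x + t k *\<^sub>R b) \<ge> 1 \<and> norm x \<ge> 1" if "norm x > 2" for x k
    using norm_diff_ineq[of x "t k *\<^sub>R b"] that b t[of k] by simp
  have int\<phi>: "integrable lborel \<phi>"
  proof -
    have "integrable lborel (\<lambda>x. indicator (cball 0 1) x *\<^sub>R \<phi> x)"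
      using cont continuous_on_subset by (intro borel_integrable_compact) auto
    also have "(\<lambda>x. indicator (cball 0 1) x *\<^sub>R \<phi> x) = \<phi>"
      using supp by (auto simp: fun_eq_iff indicator_def)
    finally show ?thesis .
  qed
  \<comment> \<open>Each difference quotient has integral 0 by translation invariance. The Lipschitz
    constant, restricted to the ball of radius 2, dominates them all, so the integral of the limit
    is 0 as well.\<close>
  have "(\<lambda>k. \<integral>x. (\<phi> (x + t k *\<^sub>R b) - \<phi> x) / t k \<partial>lborel) \<longlonglongrightarrow> (\<integral>x. \<psi> x \<partial>lborel)"
  proof (rule integral_dominated_convergence[where w="\<lambda>x. indicator (cball 0 2) x *\<^sub>R L"])
    show "integrable lborel (\<lambda>x. indicator (cball (0::'a) 2) x *\<^sub>R L)"
      by (intro borel_integrable_compact) auto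
    show "AE x in lborel. (\<lambda>k. (\<phi> (x + t k *\<^sub>R b) - \<phi> x) / t k) \<longlonglongrightarrow> \<psi> x"
      using deriv
    proof eventually_elim
      case (elim x)
      then have "((\<lambda>s. (\<phi> (x + s *\<^sub>R b) - \<phi> x) / s) \<longlongrightarrow> \<psi> x) (at 0)"
        by (simp add: DERIV_def)
      then have "((\<lambda>s. (\<phi> (x + s *\<^sub>R b) - \<phi> x) / s) \<circ> t) \<longlonglongrightarrow> \<psi> x"
        using t t0 unfolding tendsto_at_iff_sequentially by (auto simp: less_imp_neq[symmetric])
      then show ?case by (simp add: comp_def)
    qed
    show "AE x in lborel. norm ((\<phi> (x + t k *\<^sub>R b) - \<phi> x) / t k) \<le> indicator (cball 0 2) x *\<^sub>R L" for k
    proof (rule AE_I2)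
      fix x
      show "norm ((\<phi> (x + t k *\<^sub>R b) - \<phi> x) / t k) \<le> indicator (cball 0 2) x *\<^sub>R L"
      proof (cases "norm x > 2")
        case True
        then show ?thesis using far[OF True, of k] supp by simp
      next
        case False
        then show ?thesis using bound[where x=x and k=k] t[of k] by (simp add: field_simps)
      qed
    qed
  qed (use \<psi> in auto)
  moreover have "(\<integral>x. (\<phi> (x + t k *\<^sub>R b) - \<phi> x) / t k \<partial>lborel) = 0" for k
  proof -
    have "integrable lborel (\<lambda>x. \<phi> (t k *\<^sub>R b + x))"
      using int\<phi> integrable_distr_eq[of "(+) (t k *\<^sub>R b)" lborel borel \<phi>] by (simp add: lborel_distr_plus)
    moreover have "(\<integral>x. \<phi> (t k *\<^sub>R b + x) \<partial>lborel) = (\<integral>x. \<phi> x \<partial>lborel)"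
      by (rule lborel_integral_translate) simp
    ultimately show ?thesis using int\<phi> by (simp add: add.commute)
  qed
  ultimately have "(\<lambda>k::nat. 0) \<longlonglongrightarrow> (\<integral>x. \<psi> x \<partial>lborel)" by (simp only:)
  then show ?thesis by (simp add: LIMSEQ_const_iff)
qed

lemma has_derivative_imp_directional:
  assumes "(F has_derivative F') (at x)"
  shows "((\<lambda>t::real. F (x + t *\<^sub>R b)) has_real_derivative F' b) (at 0)"
proof -
  interpret F': bounded_linear F' using assms by (rule has_derivative_bounded_linear)
  have "((\<lambda>t. F (x + t *\<^sub>R b)) has_derivative (\<lambda>t. F' (t *\<^sub>R b))) (at 0)"
    by (rule has_derivative_compose[where f="\<lambda>t. x + t *\<^sub>R b" and g=F and g'=F'])
       (auto intro!: derivative_eq_intros assms)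
  then show ?thesis
    by (simp add: has_field_derivative_def F'.scaleR mult_commute_abs)
qed

text \<open>Used to discard the spheres of radii \<open>1 - \<delta>\<close> and 1, on which the
  cutoff has its kinks.\<close>

lemma AE_lborel_norm_neq: "AE x in lborel. norm (x :: 'a::euclidean_space) \<noteq> r"
proof -
  have "sphere (0::'a) r \<in> null_sets (completion lborel)"
    using negligible_sphere[of "0::'a" r] by (simp only: negligible_iff_null_sets)
  then have "sphere (0::'a) r \<in> null_sets lborel"
    by (subst (asm) null_sets_completion_iff) auto
  then have "AE x in lborel. x \<notin> sphere (0::'a) r" by (rule AE_not_in)
  then show ?thesis by eventually_elim simp
qed

definition radial_cutoff :: "real \<Rightarrow> 'a::real_normed_vector \<Rightarrow> real" where
  "radial_cutoff \<delta> x = max 0 (min 1 ((1 - norm x) / \<delta>))"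

lemma radial_cutoff_bounds: "0 \<le> radial_cutoff \<delta> x" "radial_cutoff \<delta> x \<le> 1"
  by (auto simp: radial_cutoff_def)

lemma radial_cutoff_eq_0: "\<delta> > 0 \<Longrightarrow> norm x \<ge> 1 \<Longrightarrow> radial_cutoff \<delta> x = 0"
  by (auto simp: radial_cutoff_def field_simps)

lemma radial_cutoff_eq_1: "\<delta> > 0 \<Longrightarrow> norm x \<le> 1 - \<delta> \<Longrightarrow> radial_cutoff \<delta> x = 1"
  by (auto simp: radial_cutoff_def field_simps)

lemma radial_cutoff_eq_mid:
  "\<delta> > 0 \<Longrightarrow> 1 - \<delta> \<le> norm x \<Longrightarrow> norm x \<le> 1 \<Longrightarrow> radial_cutoff \<delta> x = (1 - norm x) / \<delta>"
  by (auto simp: radial_cutoff_def field_simps)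

text \<open>Clamping to the interval from 0 to 1 does not increase distances, so the slope
  \<open>1 / \<delta>\<close> of the unclamped function survives as a Lipschitz constant.\<close>

lemma radial_cutoff_diff:
  assumes "\<delta> > 0" shows "\<bar>radial_cutoff \<delta> x - radial_cutoff \<delta> y\<bar> \<le> norm (x - y) / \<delta>"
proof -
  have "\<bar>radial_cutoff \<delta> x - radial_cutoff \<delta> y\<bar> \<le> \<bar>(1 - norm x) / \<delta> - (1 - norm y) / \<delta>\<bar>"
    unfolding radial_cutoff_def by linarith
  also have "\<dots> = \<bar>norm x - norm y\<bar> / \<delta>"
    using assms by (simp add: abs_minus_commute flip: diff_divide_distrib)
  also have "\<dots> \<le> norm (x - y) / \<delta>"
    using assms by (intro divide_right_mono norm_triangle_ineq3) auto
  finally show ?thesis .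
qed

lemma continuous_on_radial_cutoff: "\<delta> > 0 \<Longrightarrow> continuous_on S (radial_cutoff \<delta>)"
  unfolding radial_cutoff_def by (intro continuous_intros) auto

lemma borel_measurable_radial_cutoff:
  "\<delta> > 0 \<Longrightarrow> (radial_cutoff \<delta> :: 'a::euclidean_space \<Rightarrow> real) \<in> borel_measurable borel"
  by (intro borel_measurable_continuous_onI continuous_on_radial_cutoff)

text \<open>Integration by parts: the product of cutoff and \<open>v\<close> vanishes outside the
  unit ball, so its derivative along \<open>b\<close> has integral 0. The product rule splits this
  derivative into the left-hand integrand and a term that lives on the shell, where the cutoff has
  gradient \<open>- sgn x / \<delta>\<close>.\<close>

lemma set_integral_cutoff_eq_shell:
  fixes v :: "'a::euclidean_space \<Rightarrow> real"
  assumes deriv: "\<And>x. norm x \<le> 1 \<Longrightarrow> (v has_derivative (\<lambda>h. g x \<bullet> h)) (at x)"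
    and cont: "continuous_on (cball 0 1) g"
    and lip: "M-lipschitz_on (cball 0 1) v"
    and b: "norm b = 1" and \<delta>: "0 < \<delta>" "\<delta> < 1"
  shows "(LINT x:ball 0 1|lborel. radial_cutoff \<delta> x * (g x \<bullet> b))
       = (LINT x:ball 0 1 - ball 0 (1 - \<delta>)|lborel. (sgn x \<bullet> b) * v x) / \<delta>"
proof -
  let ?W = "radial_cutoff \<delta> :: 'a \<Rightarrow> real"
  let ?S = "ball (0::'a) 1 - ball 0 (1 - \<delta>)"
  note [measurable] = borel_measurable_radial_cutoff[OF \<delta>(1)]
  define \<phi> where "\<phi> = (\<lambda>x. ?W x * v x)"
  define \<psi>1 where "\<psi>1 = (\<lambda>x. indicator (ball 0 1) x * (?W x * (g x \<bullet> b)))"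
  define \<psi>2 where "\<psi>2 = (\<lambda>x. indicator ?S x * ((sgn x \<bullet> b) * v x / \<delta>))"
  have contv: "continuous_on (cball 0 1) v"
    using lip by (rule lipschitz_on_continuous_on)
  have "compact (v ` cball 0 1)" "compact (g ` cball 0 1)"
    using contv cont by (auto intro: compact_continuous_image)
  then obtain K C where K: "\<And>x. norm x \<le> 1 \<Longrightarrow> \<bar>v x\<bar> \<le> K" and C: "\<And>x. norm x \<le> 1 \<Longrightarrow> norm (g x) \<le> C"
    by (fastforce dest!: compact_imp_bounded simp: bounded_iff)
  have K0: "0 \<le> K" using K[of 0] by simp
  have M0: "0 \<le> M" using lip by (rule lipschitz_on_nonneg)
  \<comment> \<open>Continuity is known on the closed ball only, so measurability on the whole space
    is obtained for the truncated functions, which agree with \<open>g\<close> and \<open>v\<close>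
    wherever \<open>\<psi>1\<close> and \<open>\<psi>2\<close> are nonzero.\<close>
  have G[measurable]: "(\<lambda>x. indicator (cball 0 1) x *\<^sub>R g x) \<in> borel_measurable borel"
    using cont by (intro borel_measurable_continuous_on_indicator) auto
  have V[measurable]: "(\<lambda>x. indicator (cball 0 1) x *\<^sub>R v x) \<in> borel_measurable borel"
    using contv by (intro borel_measurable_continuous_on_indicator) auto
  have "\<psi>1 = (\<lambda>x. indicator (ball 0 1) x * (?W x * ((indicator (cball 0 1) x *\<^sub>R g x) \<bullet> b)))"
    by (auto simp: \<psi>1_def fun_eq_iff indicator_def)
  then have \<psi>1[measurable]: "\<psi>1 \<in> borel_measurable borel"
    by (simp only:) (intro borel_measurable_times borel_measurable_divide borel_measurable_indicator
        borel_measurable_inner borel_measurable_const borel_measurable_sgn borel_measurable_radial_cutoff \<delta> G V, simp_all)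
  have "\<psi>2 = (\<lambda>x. indicator ?S x * ((sgn x \<bullet> b) * (indicator (cball 0 1) x *\<^sub>R v x) / \<delta>))"
    by (auto simp: \<psi>2_def fun_eq_iff indicator_def)
  then have \<psi>2[measurable]: "\<psi>2 \<in> borel_measurable borel"
    by (simp only:) (intro borel_measurable_times borel_measurable_divide borel_measurable_indicator
        borel_measurable_inner borel_measurable_const borel_measurable_sgn borel_measurable_radial_cutoff \<delta> G V, simp_all)
  have int1: "integrable lborel \<psi>1"
  proof -
    have "integrable lborel (\<lambda>x. indicator (ball 0 1) x *\<^sub>R \<psi>1 x)"
    proof (rule integrableI_bounded_set_indicator[where B=C])
      show "AE x in lborel. x \<in> ball 0 1 \<longrightarrow> norm (\<psi>1 x) \<le> C"
      proof (intro AE_I2 impI)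
        fix x :: 'a assume x: "x \<in> ball 0 1"
        have "\<bar>g x \<bullet> b\<bar> \<le> C" using Cauchy_Schwarz_ineq2[of "g x" b] C[of x] b x by simp
        then have "?W x * \<bar>g x \<bullet> b\<bar> \<le> 1 * C"
          using radial_cutoff_bounds[of \<delta> x] by (intro mult_mono) auto
        then show "norm (\<psi>1 x) \<le> C"
          using x radial_cutoff_bounds[of \<delta> x] by (simp add: \<psi>1_def abs_mult)
      qed
    qed (use emeasure_lborel_ball_finite[of "0::'a" 1] in auto)
    also have "(\<lambda>x. indicator (ball 0 1) x *\<^sub>R \<psi>1 x) = \<psi>1"
      by (auto simp: fun_eq_iff \<psi>1_def indicator_def)
    finally show ?thesis .
  qed
  have int2: "integrable lborel \<psi>2"
  proof -
    have "integrable lborel (\<lambda>x. indicator (ball 0 1) x *\<^sub>R \<psi>2 x)"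
    proof (rule integrableI_bounded_set_indicator[where B="K / \<delta>"])
      show "AE x in lborel. x \<in> ball 0 1 \<longrightarrow> norm (\<psi>2 x) \<le> K / \<delta>"
      proof (intro AE_I2 impI)
        fix x :: 'a assume x: "x \<in> ball 0 1"
        have "\<bar>sgn x \<bullet> b\<bar> \<le> 1" using Cauchy_Schwarz_ineq2[of "sgn x" b] b by (auto simp: norm_sgn split: if_splits)
        then have "\<bar>sgn x \<bullet> b\<bar> * \<bar>v x\<bar> \<le> 1 * K"
          using K[of x] x by (intro mult_mono) auto
        then have "\<bar>sgn x \<bullet> b\<bar> * \<bar>v x\<bar> / \<delta> \<le> K / \<delta>"
          using \<delta> by (intro divide_right_mono) auto
        then show "norm (\<psi>2 x) \<le> K / \<delta>"
          using \<delta> K0 by (auto simp: \<psi>2_def abs_mult indicator_def)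
      qed
    qed (use emeasure_lborel_ball_finite[of "0::'a" 1] in auto)
    also have "(\<lambda>x. indicator (ball 0 1) x *\<^sub>R \<psi>2 x) = \<psi>2"
      by (auto simp: fun_eq_iff \<psi>2_def indicator_def)
    finally show ?thesis .
  qed
  \<comment> \<open>One point is kept in the closed ball. If the other lies outside, the cutoff
    vanishes there, so the uncontrolled values of \<open>v\<close> outside the ball never
    enter.\<close>
  have near: "\<bar>\<phi> x - \<phi> y\<bar> \<le> (K / \<delta> + M) * norm (x - y)" if "norm x \<le> 1" for x y
  proof (cases "norm y \<le> 1")
    case True
    have "\<phi> x - \<phi> y = ?W y * (v x - v y) + (?W x - ?W y) * v x"
      by (simp add: \<phi>_def algebra_simps)
    also have "\<bar>\<dots>\<bar> \<le> \<bar>?W y\<bar> * \<bar>v x - v y\<bar> + \<bar>?W x - ?W y\<bar> * \<bar>v x\<bar>"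
      by (metis abs_mult abs_triangle_ineq)
    also have "\<dots> \<le> 1 * (M * norm (x - y)) + norm (x - y) / \<delta> * K"
      using lipschitz_onD[OF lip, of x y] that True radial_cutoff_bounds[of \<delta> y] K[OF that] K0 \<delta>
        radial_cutoff_diff[OF \<delta>(1)]
      by (intro add_mono mult_mono) (auto simp: dist_norm)
    finally show ?thesis by (simp add: algebra_simps)
  next
    case False
    then have "\<phi> x - \<phi> y = (?W x - ?W y) * v x"
      using radial_cutoff_eq_0[OF \<delta>(1), of y] by (simp add: \<phi>_def)
    also have "\<bar>\<dots>\<bar> \<le> norm (x - y) / \<delta> * K"
      unfolding abs_mult using K[OF that] K0 \<delta> radial_cutoff_diff[OF \<delta>(1)] by (intro mult_mono) auto
    also have "\<dots> \<le> (K / \<delta> + M) * norm (x - y)" using M0 by (simp add: algebra_simps)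
    finally show ?thesis .
  qed
  have out: "\<phi> x = 0" if "norm x \<ge> 1" for x
    using radial_cutoff_eq_0[OF \<delta>(1) that] by (simp add: \<phi>_def)
  have "(K / \<delta> + M)-lipschitz_on UNIV \<phi>"
  proof (rule lipschitz_onI)
    fix x y :: 'a
    show "dist (\<phi> x) (\<phi> y) \<le> (K / \<delta> + M) * dist x y"
    proof (cases "norm x \<le> 1 \<or> norm y \<le> 1")
      case True
      then show ?thesis using near[of x y] near[of y x]
        by (auto simp: dist_norm norm_minus_commute abs_minus_commute)
    qed (use out K0 M0 \<delta> in auto)
  qed (use K0 M0 \<delta> in auto)
  moreover have "AE x in lborel. ((\<lambda>t. \<phi> (x + t *\<^sub>R b)) has_real_derivative (\<psi>1 x - \<psi>2 x)) (at 0)"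
    using AE_lborel_norm_neq[of 1] AE_lborel_norm_neq[of "1 - \<delta>"]
  proof eventually_elim
    case (elim x)
    \<comment> \<open>On these open regions the cutoff is 1, affine in the norm, or 0, so
      \<open>\<phi>\<close> agrees near \<open>x\<close> with an explicit differentiable function.
      In the middle region \<open>\<delta> < 1\<close> keeps \<open>x\<close> away from 0, where the
      norm is not differentiable.\<close>
    consider "norm x < 1 - \<delta>" | "1 - \<delta> < norm x" "norm x < 1" | "norm x > 1"
      using elim by linarith
    then show ?case
    proof cases
      case 1
      have "(\<phi> has_derivative (\<lambda>h. g x \<bullet> h)) (at x)"
      proof (rule has_derivative_transform_within_open)
        show "(v has_derivative (\<lambda>h. g x \<bullet> h)) (at x)" using deriv 1 \<delta> by simp
        show "open (ball (0::'a) (1 - \<delta>))" "x \<in> ball 0 (1 - \<delta>)" using 1 by auto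
        show "v y = \<phi> y" if "y \<in> ball 0 (1 - \<delta>)" for y
          using that radial_cutoff_eq_1[OF \<delta>(1), of y] by (simp add: \<phi>_def)
      qed
      then show ?thesis using 1 \<delta> radial_cutoff_eq_1[OF \<delta>(1), of x] 
        by (auto dest!: has_derivative_imp_directional[where b=b] simp: \<psi>1_def \<psi>2_def)
    next
      case 2
      have x0: "x \<noteq> 0" using 2 \<delta> by auto
      have "(\<phi> has_derivative (\<lambda>h. ?W x * (g x \<bullet> h) - (sgn x \<bullet> h) * v x / \<delta>)) (at x)"
      proof (rule has_derivative_transform_within_open)
        show "((\<lambda>y. (1 - norm y) / \<delta> * v y) has_derivative (\<lambda>h. ?W x * (g x \<bullet> h) - (sgn x \<bullet> h) * v x / \<delta>)) (at x)"
          using 2 \<delta> by (auto intro!: derivative_eq_intros deriv has_derivative_norm[OF x0]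
              simp: radial_cutoff_eq_mid inner_commute fun_eq_iff field_simps)
        show "open (ball (0::'a) 1 - cball 0 (1 - \<delta>))" "x \<in> ball (0::'a) 1 - cball 0 (1 - \<delta>)" using 2 by auto
        show "(1 - norm y) / \<delta> * v y = \<phi> y" if "y \<in> ball (0::'a) 1 - cball 0 (1 - \<delta>)" for y
          using that radial_cutoff_eq_mid[OF \<delta>(1), of y] by (simp add: \<phi>_def)
      qed
      then show ?thesis using 2
        by (auto dest!: has_derivative_imp_directional[where b=b] simp: \<psi>1_def \<psi>2_def)
    next
      case 3
      have "(\<phi> has_derivative (\<lambda>h. 0)) (at x)"
      proof (rule has_derivative_transform_within_open)
        show "((\<lambda>_. 0) has_derivative (\<lambda>h. 0)) (at x)" by simp
        show "open (- cball (0::'a) 1)" "x \<in> - cball (0::'a) 1" using 3 by auto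
        show "0 = \<phi> y" if "y \<in> - cball (0::'a) 1" for y using that out[of y] by simp
      qed
      then show ?thesis using 3
        by (auto dest!: has_derivative_imp_directional[where b=b] simp: \<psi>1_def \<psi>2_def)
    qed
  qed
  ultimately have "(\<integral>x. \<psi>1 x - \<psi>2 x \<partial>lborel) = 0"
    using out b by (intro integral_directional_derivative_eq_0) auto
  then have "(\<integral>x. \<psi>1 x \<partial>lborel) = (\<integral>x. \<psi>2 x \<partial>lborel)"
    using int1 int2 by simp
  then show ?thesis
    by (simp add: \<psi>1_def \<psi>2_def set_lebesgue_integral_def)
qed

lemma set_integrable_unit_ball:
  fixes f :: "'a::euclidean_space \<Rightarrow> 'b::{banach, second_countable_topology}"
  assumes "continuous_on (cball 0 1) f"
  shows "set_integrable lborel (ball 0 1) f"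
proof (rule set_integrable_subset)
  show "set_integrable lborel (cball 0 1) f"
    unfolding set_integrable_def using assms by (intro borel_integrable_compact) auto
qed auto

lemma gradient_continuous_imp_lipschitz:
  fixes v :: "'a::euclidean_space \<Rightarrow> real"
  assumes deriv: "\<And>x. norm x \<le> 1 \<Longrightarrow> (v has_derivative (\<lambda>h. g x \<bullet> h)) (at x)"
    and cont: "continuous_on (cball 0 1) g"
  obtains M where "M-lipschitz_on (cball 0 1) v"
proof -
  have "bounded (g ` cball 0 1)"
    using cont by (intro compact_imp_bounded compact_continuous_image) auto
  then obtain M where M: "norm (g x) \<le> M" if "norm x \<le> 1" for x
    unfolding bounded_iff by (metis imageI mem_cball_0)
  have M0: "0 \<le> M" using M[of 0] norm_ge_zero[of "g 0"] by (simp del: norm_ge_zero)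
  have "M-lipschitz_on (cball 0 1) v"
  proof (rule bounded_derivative_imp_lipschitz[where f'="\<lambda>x h. g x \<bullet> h"])
    show "(v has_derivative (\<lambda>h. g x \<bullet> h)) (at x within cball 0 1)" if "x \<in> cball 0 1" for x
      using deriv[of x] that by (auto intro: has_derivative_at_withinI)
    show "onorm (\<lambda>h. g x \<bullet> h) \<le> M" if "x \<in> cball 0 1" for x
    proof (rule onorm_bound[OF M0])
      fix h
      show "norm (g x \<bullet> h) \<le> M * norm h"
        using Cauchy_Schwarz_ineq2[of "g x" h] mult_right_mono[OF M, of x "norm h"] that by simp
    qed
  qed (use M0 in auto)
  then show ?thesis by (rule that)
qed

text \<open>Let the shell width tend to 0 in the cutoff identity. The cutoff tends to 1 inside the
  ball, which gives the volume integral. On the shell \<open>v x\<close> may be replaced by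
  \<open>v (sgn x)\<close>, after which the integrand is constant along rays and the shell
  contributes its explicit weight.\<close>

lemma gauss_unit_ball_scalar:
  fixes v :: "'a::euclidean_space \<Rightarrow> real"
  assumes deriv: "\<And>x. norm x \<le> 1 \<Longrightarrow> (v has_derivative (\<lambda>h. g x \<bullet> h)) (at x)"
    and cont: "continuous_on (cball 0 1) g"
    and b: "norm b = 1"
  shows "(LINT x:ball 0 1|lborel. g x \<bullet> b)
       = DIM('a) * measure lborel (ball (0::'a) 1) * (\<integral>z. (z \<bullet> b) * v z \<partial>sphere_measure)"
proof -
  obtain M where lip: "M-lipschitz_on (cball 0 1) v"
    using gradient_continuous_imp_lipschitz[OF deriv cont] by auto
  have M0: "0 \<le> M" using lip by (rule lipschitz_on_nonneg)
  have contv: "continuous_on (cball 0 1) v"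
    using lip by (rule lipschitz_on_continuous_on)
  let ?V = "measure lborel (ball (0::'a) 1)"
  let ?n = "DIM('a)"
  \<comment> \<open>The double successor keeps \<open>\<delta> k\<close> strictly below 1, so the
    inner ball has positive radius.\<close>
  define \<delta> :: "nat \<Rightarrow> real" where "\<delta> = (\<lambda>k. inverse (real (Suc (Suc k))))"
  have \<delta>: "0 < \<delta> k" "\<delta> k < 1" for k by (auto simp: \<delta>_def field_simps)
  have \<delta>0: "\<delta> \<longlonglongrightarrow> 0" unfolding \<delta>_def by (rule LIMSEQ_Suc) (rule LIMSEQ_inverse_real_of_nat)
  let ?h = "\<lambda>z. (z \<bullet> b) * v z"
  let ?I = "\<integral>z. ?h z \<partial>sphere_measure"
  let ?S = "\<lambda>k. ball (0::'a) 1 - ball 0 (1 - \<delta> k)"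
  define J where "J = (\<lambda>k. (LINT x:?S k|lborel. (sgn x \<bullet> b) * v x) / \<delta> k)"
  have hm: "?h \<in> borel_measurable sphere_measure"
    using continuous_on_subset[OF contv, of "sphere 0 1"]
    by (intro borel_measurable_sphere_continuous continuous_intros) auto

  have shell: "(LINT x:?S k|lborel. f (sgn x)) = (1 - (1 - \<delta> k) ^ ?n) * (?V * (\<integral>z. f z \<partial>sphere_measure))"
    and shell_integrable: "set_integrable lborel (?S k) (\<lambda>x. f (sgn x))"
    if fm: "f \<in> borel_measurable sphere_measure" and fb: "\<And>z. norm (f z) \<le> C" for f :: "'a \<Rightarrow> real" and C k
  proof -
    have int: "set_integrable lborel (ball 0 r) (\<lambda>x. f (sgn x))" for r
      unfolding set_integrable_def
      using fb borel_measurable_compose_sgn[OF fm] emeasure_lborel_ball_finite[of "0::'a" r]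
      by (intro integrableI_bounded_set_indicator[where B=C]) auto
    have "(LINT x:?S k|lborel. f (sgn x)) = (LINT x:ball 0 1|lborel. f (sgn x)) - (LINT x:ball 0 (1 - \<delta> k)|lborel. f (sgn x))"
    proof -
      have "(\<lambda>x. indicator (?S k) x *\<^sub>R f (sgn x))
          = (\<lambda>x. indicator (ball 0 1) x *\<^sub>R f (sgn x) - indicator (ball 0 (1 - \<delta> k)) x *\<^sub>R f (sgn x))"
        using \<delta>[of k] by (auto simp: indicator_def fun_eq_iff)
      then show ?thesis
        using int[of 1] int[of "1 - \<delta> k"]
        unfolding set_lebesgue_integral_def set_integrable_def by (simp only: Bochner_Integration.integral_diff)
    qed
    also have "\<dots> = (1 - (1 - \<delta> k) ^ ?n) * (LINT x:ball 0 1|lborel. f (sgn x))"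
      using set_integral_ball_compose_sgn[OF fm, of "1 - \<delta> k"] \<delta>[of k] by (simp add: algebra_simps)
    finally show "(LINT x:?S k|lborel. f (sgn x)) = (1 - (1 - \<delta> k) ^ ?n) * (?V * (\<integral>z. f z \<partial>sphere_measure))"
      using integral_sphere_measure[OF fm] by simp
    show "set_integrable lborel (?S k) (\<lambda>x. f (sgn x))"
      using int[of 1] by (rule set_integrable_subset) auto
  qed

  have "(\<lambda>k. LINT x:ball 0 1|lborel. radial_cutoff (\<delta> k) x * (g x \<bullet> b)) \<longlonglongrightarrow> (LINT x:ball 0 1|lborel. g x \<bullet> b)"
    unfolding set_lebesgue_integral_def
  proof (rule integral_dominated_convergence[where w="\<lambda>x. norm (indicator (ball 0 1) x *\<^sub>R (g x \<bullet> b))"])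
    have int: "integrable lborel (\<lambda>x. indicator (ball 0 1) x *\<^sub>R (g x \<bullet> b))"
      using set_integrable_unit_ball[OF continuous_on_inner[OF cont continuous_on_const]]
      by (simp add: set_integrable_def)
    then show "integrable lborel (\<lambda>x. norm (indicator (ball 0 1) x *\<^sub>R (g x \<bullet> b)))"
      by (rule integrable_norm)
    show m: "(\<lambda>x. indicator (ball 0 1) x *\<^sub>R (g x \<bullet> b)) \<in> borel_measurable lborel"
      using int by (rule borel_measurable_integrable)
    show "(\<lambda>x. indicator (ball 0 1) x *\<^sub>R (radial_cutoff (\<delta> k) x * (g x \<bullet> b))) \<in> borel_measurable lborel" for k
    proof -
      have "(\<lambda>x. radial_cutoff (\<delta> k) x * (indicator (ball 0 1) x *\<^sub>R (g x \<bullet> b))) \<in> borel_measurable lborel"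
        using m borel_measurable_radial_cutoff[OF \<delta>(1)] by (intro borel_measurable_times) auto
      then show ?thesis by (simp add: ac_simps)
    qed
    show "AE x in lborel. norm (indicator (ball 0 1) x *\<^sub>R (radial_cutoff (\<delta> k) x * (g x \<bullet> b)))
        \<le> norm (indicator (ball 0 1) x *\<^sub>R (g x \<bullet> b))" for k
      by (intro AE_I2) (auto simp: indicator_def abs_mult radial_cutoff_bounds intro!: mult_left_le_one_le)
    show "AE x in lborel. (\<lambda>k. indicator (ball 0 1) x *\<^sub>R (radial_cutoff (\<delta> k) x * (g x \<bullet> b)))
        \<longlonglongrightarrow> indicator (ball 0 1) x *\<^sub>R (g x \<bullet> b)"
    proof (intro AE_I2)
      fix x :: 'a
      show "(\<lambda>k. indicator (ball 0 1) x *\<^sub>R (radial_cutoff (\<delta> k) x * (g x \<bullet> b)))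
        \<longlonglongrightarrow> indicator (ball 0 1) x *\<^sub>R (g x \<bullet> b)"
      proof (cases "x \<in> ball 0 1")
        case True
        then have "\<forall>\<^sub>F k in sequentially. \<delta> k < 1 - norm x"
          using order_tendstoD(2)[OF \<delta>0, of "1 - norm x"] by simp
        then have "\<forall>\<^sub>F k in sequentially. indicator (ball 0 1) x *\<^sub>R (radial_cutoff (\<delta> k) x * (g x \<bullet> b))
            = indicator (ball 0 1) x *\<^sub>R (g x \<bullet> b)"
          by eventually_elim (simp add: radial_cutoff_eq_1 \<delta>)
        then show ?thesis by (rule tendsto_eventually)
      qed simp
    qed
  qed
  then have lim1: "J \<longlonglongrightarrow> (LINT x:ball 0 1|lborel. g x \<bullet> b)"
    using set_integral_cutoff_eq_shell[OF deriv cont lip b \<delta>] by (simp add: J_def)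

  \<comment> \<open>The relative volume of the shell per unit width. Its limit is the derivative of
    \<open>1 - (1 - s) ^ n\<close> at 0, which is where the factor \<open>n\<close> (the ratio of
    surface area to volume of the unit ball) comes from.\<close>
  define c where "c = (\<lambda>k. (1 - (1 - \<delta> k) ^ ?n) / \<delta> k)"
  have lim_c: "c \<longlonglongrightarrow> ?n"
  proof -
    have "((\<lambda>s::real. 1 - (1 - s) ^ ?n) has_real_derivative ?n) (at 0)"
      by (auto intro!: derivative_eq_intros)
    then have "((\<lambda>s::real. (1 - (1 - s) ^ ?n) / s) \<longlongrightarrow> ?n) (at 0)"
      by (simp add: DERIV_def)
    then have "((\<lambda>s::real. (1 - (1 - s) ^ ?n) / s) \<circ> \<delta>) \<longlonglongrightarrow> ?n"
      using \<delta> \<delta>0 unfolding tendsto_at_iff_sequentially by (auto simp: less_imp_neq[symmetric])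
    then show ?thesis by (simp add: c_def comp_def)
  qed
  \<comment> \<open>Moving a point of the shell radially to the sphere costs at most
    \<open>M * \<delta> k\<close> in \<open>v\<close>. Integrated over a shell of volume
    \<open>?V * (c k * \<delta> k)\<close> and divided by \<open>\<delta> k\<close>, the error still
    tends to 0.\<close>
  have close: "norm (J k - c k * (?V * ?I)) \<le> M * ?V * (c k * \<delta> k)" for k
  proof -
    have "bounded (v ` sphere 0 1)"
      using continuous_on_subset[OF contv, of "sphere 0 1"]
      by (intro compact_imp_bounded compact_continuous_image) auto
    then obtain K where K: "\<bar>v z\<bar> \<le> K" if "norm z = 1" for z
      unfolding bounded_iff real_norm_def by (metis imageI mem_sphere_0)
    \<comment> \<open>\<open>shell\<close> asks for a bound at every point, while \<open>v\<close>
      is bounded by \<open>K\<close> on the sphere only; hence the truncation. At the origin both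
      sides of \<open>hx\<close> are 0.\<close>
    define h where "h = (\<lambda>z. indicator (sphere 0 1) z * ?h z)"
    have hI: "(\<integral>z. h z \<partial>sphere_measure) = ?I"
      by (rule Bochner_Integration.integral_cong) (auto simp: h_def)
    have hm': "h \<in> borel_measurable sphere_measure"
      unfolding h_def using hm by (subst measurable_cong[where g="?h"]) auto
    have hb: "norm (h z) \<le> K" for z
    proof (cases "norm z = 1")
      case True
      have "\<bar>z \<bullet> b\<bar> * \<bar>v z\<bar> \<le> 1 * K"
        using Cauchy_Schwarz_ineq2[of z b] b True K[OF True] by (intro mult_mono) auto
      then show ?thesis using True by (simp add: h_def abs_mult)
    next
      case False
      have "0 \<le> K" using K[of b] b by linarith
      then show ?thesis using False by (simp add: h_def)
    qed
    have hx: "h (sgn x) = (sgn x \<bullet> b) * v (sgn x)" for x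
      by (cases "x = 0") (auto simp: h_def norm_sgn)
    have int1: "set_integrable lborel (?S k) (\<lambda>x. (sgn x \<bullet> b) * v x)"
    proof (rule set_integrable_subset)
      have V: "set_integrable lborel (ball 0 1) v"
        using contv by (rule set_integrable_unit_ball)
      show "set_integrable lborel (ball 0 1) (\<lambda>x. (sgn x \<bullet> b) * v x)"
        unfolding set_integrable_def
      proof (rule Bochner_Integration.integrable_bound)
        show "integrable lborel (\<lambda>x. indicator (ball 0 1) x *\<^sub>R v x)" using V by (simp add: set_integrable_def)
        have "(\<lambda>x. (sgn x \<bullet> b) * (indicator (ball 0 1) x *\<^sub>R v x)) \<in> borel_measurable lborel"
          using V by (intro borel_measurable_times borel_measurable_integrable[OF V[unfolded set_integrable_def]]) auto
        then show "(\<lambda>x. indicator (ball 0 1) x *\<^sub>R ((sgn x \<bullet> b) * v x)) \<in> borel_measurable lborel"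
          by (simp add: ac_simps)
        have "\<bar>sgn x \<bullet> b\<bar> \<le> 1" for x using Cauchy_Schwarz_ineq2[of "sgn x" b] b by (auto simp: norm_sgn split: if_splits)
        then show "AE x in lborel. norm (indicator (ball 0 1) x *\<^sub>R ((sgn x \<bullet> b) * v x)) \<le> norm (indicator (ball 0 1) x *\<^sub>R v x)"
          by (intro AE_I2) (auto simp: indicator_def abs_mult intro!: mult_left_le_one_le)
      qed
    qed auto
    have int2: "set_integrable lborel (?S k) (\<lambda>x. h (sgn x))"
      by (rule shell_integrable[OF hm' hb])
    have "J k - c k * (?V * ?I) = ((LINT x:?S k|lborel. (sgn x \<bullet> b) * v x) - (LINT x:?S k|lborel. h (sgn x))) / \<delta> k"
      by (simp only: shell[OF hm' hb] J_def c_def hI times_divide_eq_left diff_divide_distrib[symmetric])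
    also have "(LINT x:?S k|lborel. (sgn x \<bullet> b) * v x) - (LINT x:?S k|lborel. h (sgn x))
        = (LINT x:?S k|lborel. (sgn x \<bullet> b) * v x - h (sgn x))"
      using int1 int2 by (simp only: set_integral_diff)
    finally have eq: "norm (J k - c k * (?V * ?I)) = norm (LINT x:?S k|lborel. (sgn x \<bullet> b) * v x - h (sgn x)) / \<delta> k"
      using \<delta>[of k] by simp
    have "norm (LINT x:?S k|lborel. (sgn x \<bullet> b) * v x - h (sgn x)) \<le> (LINT x:?S k|lborel. M * \<delta> k)"
      unfolding set_lebesgue_integral_def
    proof (rule Bochner_Integration.integral_norm_bound_integral)
      show "integrable lborel (\<lambda>x. indicator (?S k) x *\<^sub>R ((sgn x \<bullet> b) * v x - h (sgn x)))"
        using set_integral_diff(1)[OF int1 int2] by (simp only: set_integrable_def)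
      show "integrable lborel (\<lambda>x. indicator (?S k) x *\<^sub>R (M * \<delta> k))"
        using shell_integrable[of "\<lambda>_. M * \<delta> k" "norm (M * \<delta> k)" k, unfolded set_integrable_def] by simp
      fix x :: 'a
      show "norm (indicator (?S k) x *\<^sub>R ((sgn x \<bullet> b) * v x - h (sgn x))) \<le> indicator (?S k) x *\<^sub>R (M * \<delta> k)"
      proof (cases "x \<in> ?S k")
        case True
        then have x0: "x \<noteq> 0" and x: "norm x < 1" "1 - norm x \<le> \<delta> k" using \<delta>[of k] by auto
        have "x - sgn x = (norm x - 1) *\<^sub>R sgn x"
          using x0 by (simp add: sgn_div_norm algebra_simps)
        then have "norm (x - sgn x) = 1 - norm x"
          using x x0 by (simp add: norm_sgn)
        then have "\<bar>v x - v (sgn x)\<bar> \<le> M * (1 - norm x)"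
          using lipschitz_onD[OF lip, of x "sgn x"] x x0 by (simp add: dist_norm norm_sgn)
        also have "\<dots> \<le> M * \<delta> k" using x M0 by (intro mult_left_mono)
        finally have "\<bar>sgn x \<bullet> b\<bar> * \<bar>v x - v (sgn x)\<bar> \<le> 1 * (M * \<delta> k)"
          using Cauchy_Schwarz_ineq2[of "sgn x" b] b x0 by (intro mult_mono) (auto simp: norm_sgn)
        moreover have "(sgn x \<bullet> b) * v x - h (sgn x) = (sgn x \<bullet> b) * (v x - v (sgn x))"
          by (simp add: hx algebra_simps)
        ultimately show ?thesis using True by (simp only: indicator_simps abs_mult real_norm_def scaleR_one)
      qed simp
    qed
    also have "(LINT x:?S k|lborel. M * \<delta> k) = (1 - (1 - \<delta> k) ^ ?n) * (?V * (M * \<delta> k))"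
      using shell[of "\<lambda>_. M * \<delta> k" "norm (M * \<delta> k)" k] by simp
    also have "\<dots> = M * ?V * (c k * \<delta> k) * \<delta> k"
      using \<delta>[of k] by (simp add: c_def)
    finally show ?thesis
      unfolding eq using \<delta>[of k] by (simp add: pos_divide_le_eq)
  qed
  have "(\<lambda>k. M * ?V * (c k * \<delta> k)) \<longlonglongrightarrow> 0"
    using tendsto_mult_left[OF tendsto_mult[OF lim_c \<delta>0], of "M * ?V"] by simp
  moreover have "\<forall>\<^sub>F k in sequentially. norm (J k - c k * (?V * ?I)) \<le> M * ?V * (c k * \<delta> k)"
    using close by (intro always_eventually allI)
  ultimately have "(\<lambda>k. J k - c k * (?V * ?I)) \<longlonglongrightarrow> 0"
    by (rule Lim_null_comparison[rotated])
  moreover have "(\<lambda>k. c k * (?V * ?I)) \<longlonglongrightarrow> ?n * (?V * ?I)"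
    by (rule tendsto_mult_right[OF lim_c])
  ultimately have "(\<lambda>k. (J k - c k * (?V * ?I)) + c k * (?V * ?I)) \<longlonglongrightarrow> 0 + ?n * (?V * ?I)"
    by (rule tendsto_add)
  then have "J \<longlonglongrightarrow> ?n * (?V * ?I)" by simp
  from LIMSEQ_unique[OF lim1 this] show ?thesis by simp
qed

text \<open>The scalar identity is applied to each component of \<open>V\<close> in the direction of
  that component, and the results are summed.\<close>

theorem gauss_unit_ball:
  fixes V :: "'a::euclidean_space \<Rightarrow> 'a"
  assumes deriv: "\<And>x. norm x \<le> 1 \<Longrightarrow> (V has_derivative V' x) (at x)"
    and cont: "\<And>b. b \<in> Basis \<Longrightarrow> continuous_on (cball 0 1) (\<lambda>x. V' x b)"
  shows "(LINT x:ball 0 1|lborel. \<Sum>b\<in>Basis. V' x b \<bullet> b)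
       = DIM('a) * measure lborel (ball (0::'a) 1) * (\<integral>z. V z \<bullet> z \<partial>sphere_measure)"
proof -
  have contV: "continuous_on (cball 0 1) V"
    using deriv by (intro has_derivative_continuous_on[where f'=V']) (auto intro: has_derivative_at_withinI)
  \<comment> \<open>The adjoint of \<open>V' x\<close> applied to \<open>b\<close>, which for points
    of the closed ball is the gradient of the component of \<open>V\<close> along
    \<open>b\<close>.\<close>
  define g where "g = (\<lambda>b x. \<Sum>c\<in>Basis. (V' x c \<bullet> b) *\<^sub>R c)"
  have gh: "g b x \<bullet> h = V' x h \<bullet> b" if "norm x \<le> 1" for b x h
  proof -
    interpret V': bounded_linear "V' x" using deriv[OF that] by (rule has_derivative_bounded_linear)
    have "V' x h \<bullet> b = V' x (\<Sum>c\<in>Basis. (h \<bullet> c) *\<^sub>R c) \<bullet> b" by (simp add: euclidean_representation)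
    also have "\<dots> = (\<Sum>c\<in>Basis. (h \<bullet> c) * (V' x c \<bullet> b))" by (simp add: V'.sum V'.scaleR inner_sum_left)
    also have "\<dots> = g b x \<bullet> h" by (simp add: g_def inner_sum_left inner_sum_right mult.commute inner_commute)
    finally show ?thesis by simp
  qed
  have contg: "continuous_on (cball 0 1) (g b)" for b
    unfolding g_def using cont by (intro continuous_intros)
  have *: "(LINT x:ball 0 1|lborel. g b x \<bullet> b)
       = DIM('a) * measure lborel (ball (0::'a) 1) * (\<integral>z. (z \<bullet> b) * (V z \<bullet> b) \<partial>sphere_measure)" if "b \<in> Basis" for b
  proof (rule gauss_unit_ball_scalar)
    fix x :: 'a assume x: "norm x \<le> 1"
    show "((\<lambda>x. V x \<bullet> b) has_derivative (\<lambda>h. g b x \<bullet> h)) (at x)"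
      using deriv[OF x] unfolding gh[OF x] by (auto intro!: derivative_eq_intros)
  qed (use that contg in auto)
  have "(LINT x:ball 0 1|lborel. \<Sum>b\<in>Basis. V' x b \<bullet> b) = (LINT x:ball 0 1|lborel. \<Sum>b\<in>Basis. g b x \<bullet> b)"
    by (intro set_lebesgue_integral_cong) (auto simp: gh)
  also have "\<dots> = (\<Sum>b\<in>Basis. LINT x:ball 0 1|lborel. g b x \<bullet> b)"
    unfolding set_lebesgue_integral_def scaleR_sum_right
    using set_integrable_unit_ball[OF continuous_on_inner[OF contg continuous_on_const]]
    by (intro Bochner_Integration.integral_sum) (simp add: set_integrable_def)
  also have "\<dots> = DIM('a) * measure lborel (ball (0::'a) 1) * (\<Sum>b\<in>Basis. \<integral>z. (z \<bullet> b) * (V z \<bullet> b) \<partial>sphere_measure)"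
    using * by (simp add: sum_distrib_left)
  also have "(\<Sum>b\<in>Basis. \<integral>z. (z \<bullet> b) * (V z \<bullet> b) \<partial>sphere_measure) = (\<integral>z. (\<Sum>b\<in>Basis. (z \<bullet> b) * (V z \<bullet> b)) \<partial>sphere_measure)"
    using continuous_on_subset[OF contV, of "sphere 0 1"]
    by (intro Bochner_Integration.integral_sum[symmetric] integrable_sphere_continuous continuous_intros) auto
  also have "(\<lambda>z. \<Sum>b\<in>Basis. (z \<bullet> b) * (V z \<bullet> b)) = (\<lambda>z. V z \<bullet> z)"
    by (simp add: fun_eq_iff euclidean_inner[of "V x" x for x] mult.commute)
  finally show ?thesis .
qed

section \<open>Parametric integrals over the sphere\<close>

lemma norm_sphere_integral_le:
  fixes h :: "'a::euclidean_space \<Rightarrow> 'b::{banach, second_countable_topology}"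
  assumes "integrable sphere_measure h" "\<And>z. norm z = 1 \<Longrightarrow> norm (h z) \<le> B"
  shows "norm (\<integral>z. h z \<partial>sphere_measure) \<le> B"
proof -
  have "norm (\<integral>z. h z \<partial>sphere_measure) \<le> (\<integral>z. B \<partial>(sphere_measure :: 'a measure))"
    using assms by (intro Bochner_Integration.integral_norm_bound_integral) auto
  then show ?thesis by simp
qed

lemma continuous_on_parametric:
  assumes "continuous_on (U \<times> S) (\<lambda>(y, z). K y z)" "x \<in> U"
  shows "continuous_on S (K x)"
proof -
  have "continuous_on S (\<lambda>z. (x, z))" by (intro continuous_intros)
  then show ?thesis
    using continuous_on_compose2[OF assms(1), of S "\<lambda>z. (x, z)"] assms(2) by auto
qed

lemma integrable_sphere_mult:
  fixes k :: "'a::euclidean_space \<Rightarrow> 'c::{banach, second_countable_topology}"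
  assumes F: "F \<in> borel_measurable sphere_measure" "\<And>z. norm z = 1 \<Longrightarrow> \<bar>F z\<bar> \<le> C"
    and k: "continuous_on (sphere 0 1) k"
  shows "integrable sphere_measure (\<lambda>z. F z *\<^sub>R k z)"
proof -
  have "bounded (k ` sphere 0 1)"
    using k by (intro compact_imp_bounded compact_continuous_image) auto
  then obtain B where B: "norm (k z) \<le> B" if "norm z = 1" for z
    unfolding bounded_iff by force
  show ?thesis
  proof (rule integrable_sphere_bounded[where C="C * B"])
    show "(\<lambda>z. F z *\<^sub>R k z) \<in> borel_measurable sphere_measure"
      using F(1) borel_measurable_sphere_continuous[OF k] by (rule borel_measurable_scaleR)
    show "norm (F z *\<^sub>R k z) \<le> C * B" if "norm z = 1" for z
      using mult_mono'[OF F(2)[OF that] B[OF that]] by simp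
  qed
qed

text \<open>Dominated convergence along sequences. The weight \<open>F\<close> is merely measurable
  and bounded because it will be a component of \<open>sgn (B z)\<close>, which can jump across the
  kernel of \<open>B\<close>; all regularity has to come from the kernel \<open>K\<close>.\<close>

lemma continuous_on_sphere_integral:
  fixes K :: "'p::euclidean_space \<Rightarrow> 'a::euclidean_space \<Rightarrow> 'c::{banach, second_countable_topology}"
  assumes K: "continuous_on (U \<times> sphere 0 1) (\<lambda>(y, z). K y z)"
    and F: "F \<in> borel_measurable sphere_measure" "\<And>z. norm z = 1 \<Longrightarrow> \<bar>F z\<bar> \<le> C"
  shows "continuous_on U (\<lambda>x. \<integral>z. F z *\<^sub>R K x z \<partial>sphere_measure)"
proof (rule continuous_on_sequentiallyI)
  fix X :: "nat \<Rightarrow> 'p" and x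
  assume X: "\<forall>k. X k \<in> U" and x: "x \<in> U" and lim: "X \<longlonglongrightarrow> x"
  \<comment> \<open>A convergent sequence together with its limit is compact, so \<open>K\<close> is
    bounded on its product with the sphere. This supplies a constant majorant for an arbitrary
    parameter set \<open>U\<close>.\<close>
  have "compact (insert x (range X) \<times> sphere (0::'a) 1)"
    using compact_sequence_with_limit[OF lim] by (intro compact_Times) auto
  then have "bounded ((\<lambda>(y, z). K y z) ` (insert x (range X) \<times> sphere 0 1))"
    using X x by (intro compact_imp_bounded compact_continuous_image continuous_on_subset[OF K]) auto
  then obtain B where B: "norm (K (X k) z) \<le> B" if "norm z = 1" for k z
    unfolding bounded_iff by force
  show "(\<lambda>k. \<integral>z. F z *\<^sub>R K (X k) z \<partial>sphere_measure) \<longlonglongrightarrow> (\<integral>z. F z *\<^sub>R K x z \<partial>sphere_measure)"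
  proof (rule integral_dominated_convergence[where w="\<lambda>_. C * B"])
    show "AE z in sphere_measure. (\<lambda>k. F z *\<^sub>R K (X k) z) \<longlonglongrightarrow> F z *\<^sub>R K x z"
    proof (rule AE_I2)
      fix z :: 'a assume z: "z \<in> space sphere_measure"
      have "continuous_on U (\<lambda>y. (\<lambda>(y, z). K y z) (y, z))"
        by (rule continuous_on_compose2[OF K]) (use z in \<open>auto intro!: continuous_intros\<close>)
      then have "continuous_on U (\<lambda>y. K y z)" by simp
      then have "(\<lambda>k. K (X k) z) \<longlonglongrightarrow> K x z"
        using X x lim continuous_on_sequentially[of U "\<lambda>y. K y z"] by (auto simp: comp_def)
      then show "(\<lambda>k. F z *\<^sub>R K (X k) z) \<longlonglongrightarrow> F z *\<^sub>R K x z" by (intro tendsto_intros)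
    qed
    show "AE z in sphere_measure. norm (F z *\<^sub>R K (X k) z) \<le> C * B" for k
      using mult_mono'[OF F(2) B] by (intro AE_I2) simp
  qed (use X x F(1) continuous_on_parametric[OF K] borel_measurable_sphere_continuous in \<open>auto intro!: borel_measurable_scaleR\<close>)
qed

text \<open>Uniform continuity of the partial derivatives on the product of a small closed ball and
  the sphere makes the linearisation error uniform in \<open>z\<close>, so it can be integrated
  against a bounded weight.\<close>

lemma has_derivative_sphere_integral:
  fixes K :: "'p::euclidean_space \<Rightarrow> 'a::euclidean_space \<Rightarrow> 'c::{banach, second_countable_topology}"
  assumes U: "open U" "x \<in> U"
    and deriv: "\<And>y z. y \<in> U \<Longrightarrow> norm z = 1 \<Longrightarrow> ((\<lambda>y. K y z) has_derivative K' y z) (at y)"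
    and K: "continuous_on (U \<times> sphere 0 1) (\<lambda>(y, z). K y z)"
    and K': "\<And>b. b \<in> Basis \<Longrightarrow> continuous_on (U \<times> sphere 0 1) (\<lambda>(y, z). K' y z b)"
    and F: "F \<in> borel_measurable sphere_measure" "\<And>z. norm z = 1 \<Longrightarrow> \<bar>F z\<bar> \<le> C"
  shows "((\<lambda>y. \<integral>z. F z *\<^sub>R K y z \<partial>sphere_measure) has_derivative
      (\<lambda>h. \<integral>z. F z *\<^sub>R K' x z h \<partial>sphere_measure)) (at x)"
  unfolding has_derivative_at_alt
proof (intro conjI allI impI)
  have lin: "linear (K' y z)" if "y \<in> U" "norm z = 1" for y z
    using deriv[OF that] by (rule has_derivative_linear)
  \<comment> \<open>Continuity is assumed for basis directions only; linearity extends it to every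
    direction.\<close>
  have K'_expand: "K' y z h = (\<Sum>b\<in>Basis. (h \<bullet> b) *\<^sub>R K' y z b)" if "y \<in> U" "norm z = 1" for y z h
  proof -
    have "K' y z h = K' y z (\<Sum>b\<in>Basis. (h \<bullet> b) *\<^sub>R b)" by (simp add: euclidean_representation)
    also have "\<dots> = (\<Sum>b\<in>Basis. (h \<bullet> b) *\<^sub>R K' y z b)"
      using lin[OF that] by (simp add: linear_sum linear_cmul)
    finally show ?thesis .
  qed
  have contK': "continuous_on (sphere 0 1) (\<lambda>z. K' x z h)" for h
  proof -
    have "continuous_on (sphere 0 1) (\<lambda>z. \<Sum>b\<in>Basis. (h \<bullet> b) *\<^sub>R K' x z b)"
      using continuous_on_parametric[OF K' U(2)] by (intro continuous_intros) auto
    then show ?thesis by (rule continuous_on_eq) (use K'_expand[OF U(2)] in auto)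
  qed
  note int = integrable_sphere_mult[OF F contK']
  show "bounded_linear (\<lambda>h. \<integral>z. F z *\<^sub>R K' x z h \<partial>sphere_measure)"
    unfolding linear_conv_bounded_linear[symmetric]
  proof (rule linearI)
    fix h k :: 'p and r :: real
    have "(\<integral>z. F z *\<^sub>R K' x z (h + k) \<partial>sphere_measure) = (\<integral>z. F z *\<^sub>R K' x z h + F z *\<^sub>R K' x z k \<partial>sphere_measure)"
      using linear_add[OF lin[OF U(2)]] by (intro Bochner_Integration.integral_cong) (auto simp: algebra_simps)
    then show "(\<integral>z. F z *\<^sub>R K' x z (h + k) \<partial>sphere_measure)
        = (\<integral>z. F z *\<^sub>R K' x z h \<partial>sphere_measure) + (\<integral>z. F z *\<^sub>R K' x z k \<partial>sphere_measure)"
      using int by simp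
    have "(\<integral>z. F z *\<^sub>R K' x z (r *\<^sub>R h) \<partial>sphere_measure) = (\<integral>z. r *\<^sub>R (F z *\<^sub>R K' x z h) \<partial>sphere_measure)"
      using linear_cmul[OF lin[OF U(2)]] by (intro Bochner_Integration.integral_cong) (auto simp: algebra_simps)
    then show "(\<integral>z. F z *\<^sub>R K' x z (r *\<^sub>R h) \<partial>sphere_measure) = r *\<^sub>R (\<integral>z. F z *\<^sub>R K' x z h \<partial>sphere_measure)"
      by (simp only: integral_scaleR_right)
  qed
  fix e :: real assume e: "0 < e"
  obtain b0 :: 'a where b0: "norm b0 = 1" using vector_choose_size[of 1] by auto
  have C0: "0 \<le> C" using F(2)[OF b0] by linarith
  \<comment> \<open>Adding 1 keeps the denominator positive when \<open>C = 0\<close>, and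
    \<open>C * \<eta> \<le> e\<close> still holds.\<close>
  define \<eta> where "\<eta> = e / (C + 1)"
  have \<eta>: "0 < \<eta>" "C * \<eta> \<le> e" using e C0 by (auto simp: \<eta>_def field_simps)
  obtain r where r: "0 < r" "cball x r \<subseteq> U" using U open_contains_cball by blast
  \<comment> \<open>A continuous majorant of the operator norm of \<open>K' y z - K' x z\<close>. It
    vanishes at \<open>y = x\<close>, so uniform continuity makes it small near \<open>x\<close> for
    all \<open>z\<close> at once.\<close>
  define \<Theta> where "\<Theta> = (\<lambda>(y, z). \<Sum>b\<in>Basis. norm (K' y z b - K' x z b))"
  have "continuous_on (cball x r \<times> sphere 0 1) \<Theta>"
  proof -
    have "continuous_on (cball x r \<times> sphere 0 1) (\<lambda>p. K' (fst p) (snd p) b)"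
      "continuous_on (cball x r \<times> sphere 0 1) (\<lambda>p. K' x (snd p) b)" if "b \<in> Basis" for b
    proof -
      show "continuous_on (cball x r \<times> sphere 0 1) (\<lambda>p. K' (fst p) (snd p) b)"
        using continuous_on_subset[OF K'[OF that], of "cball x r \<times> sphere 0 1"] r by (auto simp: case_prod_unfold)
      show "continuous_on (cball x r \<times> sphere 0 1) (\<lambda>p. K' x (snd p) b)"
        by (rule continuous_on_compose2[OF contK'[of b]]) (auto intro!: continuous_intros)
    qed
    then show ?thesis unfolding \<Theta>_def case_prod_unfold by (intro continuous_intros)
  qed
  then have "uniformly_continuous_on (cball x r \<times> sphere 0 1) \<Theta>"
    by (intro compact_uniformly_continuous compact_Times) auto
  then obtain d where d: "0 < d" "\<And>p q. p \<in> cball x r \<times> sphere 0 1 \<Longrightarrow> q \<in> cball x r \<times> sphere 0 1 \<Longrightarrow>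
      dist q p < d \<Longrightarrow> dist (\<Theta> q) (\<Theta> p) < \<eta>"
    using \<eta>(1) unfolding uniformly_continuous_on_def by metis
  have \<Theta>: "\<Theta> (y, z) \<le> \<eta>" if "dist x y < min d r" "norm z = 1" for y z
    using d(2)[of "(x, z)" "(y, z)"] that r(1) by (auto simp: dist_Pair_Pair dist_commute \<Theta>_def dist_norm)
  show "\<exists>d>0. \<forall>y. norm (y - x) < d \<longrightarrow> norm ((\<integral>z. F z *\<^sub>R K y z \<partial>sphere_measure)
      - (\<integral>z. F z *\<^sub>R K x z \<partial>sphere_measure) - (\<integral>z. F z *\<^sub>R K' x z (y - x) \<partial>sphere_measure)) \<le> e * norm (y - x)"
  proof (intro exI[of _ "min d r"] conjI allI impI)
    fix y assume y: "norm (y - x) < min d r"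
    let ?B = "ball x (min d r)"
    have B: "?B \<subseteq> U" using r by (auto simp: subset_iff)
    have yB: "y \<in> ?B" "x \<in> ?B" using y d(1) r(1) by (auto simp: dist_norm norm_minus_commute)
    have yU: "y \<in> U" using B yB by auto
    have pt: "norm (K y z - K x z - K' x z (y - x)) \<le> norm (y - x) * \<eta>" if z: "norm z = 1" for z
    proof (rule differentiable_bound_linearization[where f="\<lambda>y. K y z" and f'="\<lambda>y. K' y z" and S="?B"])
      show "x + t *\<^sub>R (y - x) \<in> ?B" if "t \<in> {0..1}" for t
      proof -
        have "t * norm (y - x) \<le> 1 * norm (y - x)" using that by (intro mult_right_mono) auto
        then show ?thesis using y that by (simp add: dist_norm)
      qed
      show "((\<lambda>y. K y z) has_derivative K' u z) (at u within ?B)" if "u \<in> ?B" for u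
        by (rule has_derivative_at_withinI[OF deriv]) (use that B z in blast)+
      show "onorm (K' u z - K' x z) \<le> \<eta>" if u: "u \<in> ?B" for u
      proof (rule onorm_bound)
        fix h
        have "(K' u z - K' x z) h = (\<Sum>b\<in>Basis. (h \<bullet> b) *\<^sub>R (K' u z b - K' x z b))"
          using K'_expand[of u z h] K'_expand[of x z h] u B z U
          by (auto simp: scaleR_diff_right sum_subtractf)
        also have "norm \<dots> \<le> (\<Sum>b\<in>Basis. norm h * norm (K' u z b - K' x z b))"
          by (intro sum_norm_le) (auto intro!: mult_right_mono Basis_le_norm)
        also have "\<dots> = \<Theta> (u, z) * norm h" by (simp add: \<Theta>_def sum_distrib_left mult.commute)
        also have "\<dots> \<le> \<eta> * norm h" using \<Theta>[of u z] u z by (intro mult_right_mono) auto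
        finally show "norm ((K' u z - K' x z) h) \<le> \<eta> * norm h" .
      qed (use \<eta> in auto)
    qed (use yB in auto)
    note i1 = integrable_sphere_mult[OF F continuous_on_parametric[OF K yU]]
      and i2 = integrable_sphere_mult[OF F continuous_on_parametric[OF K U(2)]]
    have "norm (\<integral>z. F z *\<^sub>R K y z - F z *\<^sub>R K x z - F z *\<^sub>R K' x z (y - x) \<partial>sphere_measure)
        \<le> C * (norm (y - x) * \<eta>)"
    proof (rule norm_sphere_integral_le)
      fix z :: 'a assume z: "norm z = 1"
      have "F z *\<^sub>R K y z - F z *\<^sub>R K x z - F z *\<^sub>R K' x z (y - x) = F z *\<^sub>R (K y z - K x z - K' x z (y - x))"
        by (simp add: algebra_simps)
      also have "norm \<dots> \<le> C * (norm (y - x) * \<eta>)"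
        using mult_mono'[OF F(2)[OF z] pt[OF z]] by simp
      finally show "norm (F z *\<^sub>R K y z - F z *\<^sub>R K x z - F z *\<^sub>R K' x z (y - x)) \<le> C * (norm (y - x) * \<eta>)" .
    qed (use i1 i2 int in auto)
    also have "\<dots> \<le> e * norm (y - x)"
      using mult_right_mono[OF \<eta>(2), of "norm (y - x)"] by (simp add: ac_simps)
    finally show "norm ((\<integral>z. F z *\<^sub>R K y z \<partial>sphere_measure)
      - (\<integral>z. F z *\<^sub>R K x z \<partial>sphere_measure) - (\<integral>z. F z *\<^sub>R K' x z (y - x) \<partial>sphere_measure)) \<le> e * norm (y - x)"
      using i1 i2 int by simp
  qed (use d r in auto)
qed

section \<open>Moments of harmonic functions on spheres\<close>

lemma harmonic_onD:
  assumes "harmonic_on u S"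
  obtains g H where "\<And>x. x \<in> S \<Longrightarrow> (u has_derivative (\<lambda>h. g x \<bullet> h)) (at x)"
    "\<And>x. x \<in> S \<Longrightarrow> (g has_derivative H x) (at x)"
    "\<And>b. b \<in> Basis \<Longrightarrow> continuous_on S (\<lambda>x. H x b)"
    "\<And>x. x \<in> S \<Longrightarrow> (\<Sum>b\<in>Basis. H x b \<bullet> b) = 0"
    "continuous_on S u" "continuous_on S g"
proof -
  from assms obtain g H where *: "\<forall>x\<in>S. (u has_derivative (\<lambda>h. g x \<bullet> h)) (at x) \<and> (g has_derivative H x) (at x)"
    "\<forall>b\<in>Basis. continuous_on S (\<lambda>x. H x b)" "\<forall>x\<in>S. (\<Sum>b\<in>Basis. H x b \<bullet> b) = 0"
    unfolding harmonic_on_def by blast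
  moreover have "continuous_on S u" "continuous_on S g"
    using *(1) by (auto intro!: continuous_at_imp_continuous_on dest: has_derivative_continuous)
  ultimately show ?thesis using that by blast
qed

lemma continuous_on_dilation:
  fixes k :: "'a::euclidean_space \<Rightarrow> 'b::topological_space"
  assumes "continuous_on (ball 0 1) k"
  shows "continuous_on ({-1<..<1} \<times> sphere 0 1) (\<lambda>(s, z). k (s *\<^sub>R z))"
  unfolding case_prod_unfold
  by (rule continuous_on_compose2[OF assms]) (auto intro!: continuous_intros)

lemma scaleR_mem_unit_ball: "\<bar>r\<bar> < 1 \<Longrightarrow> norm x \<le> 1 \<Longrightarrow> r *\<^sub>R x \<in> ball 0 1"
  using mult_mono'[of "\<bar>r\<bar>" "\<bar>r\<bar>" "norm x" 1] by simp

lemma harmonic_on_transform: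
  assumes u: "harmonic_on u S" and eq: "\<And>x. x \<in> S \<Longrightarrow> u x = v x"
  shows "harmonic_on v S"
proof -
  have S: "open S" using u by (simp add: harmonic_on_def)
  from u obtain g H where *: "\<forall>x\<in>S. (u has_derivative (\<lambda>h. g x \<bullet> h)) (at x) \<and> (g has_derivative H x) (at x)"
    "\<forall>b\<in>Basis. continuous_on S (\<lambda>x. H x b)" "\<forall>x\<in>S. (\<Sum>b\<in>Basis. H x b \<bullet> b) = 0"
    unfolding harmonic_on_def by (elim conjE exE) (rule that)
  have v: "(v has_derivative (\<lambda>h. g x \<bullet> h)) (at x)" if "x \<in> S" for x
  proof (rule has_derivative_transform_within_open[OF _ S that eq])
    show "(u has_derivative (\<lambda>h. g x \<bullet> h)) (at x)" using *(1) that by blast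
  qed
  show ?thesis
    unfolding harmonic_on_def using * S v by (intro conjI exI[of _ g] exI[of _ H]) auto
qed

lemma has_derivative_along_ray:
  assumes "(u has_derivative (\<lambda>h. a \<bullet> h)) (at (t *\<^sub>R z))"
  shows "((\<lambda>t. u (t *\<^sub>R z)) has_derivative (\<lambda>h. h * (a \<bullet> z))) (at t)"
proof -
  have "((\<lambda>t. t *\<^sub>R z) has_derivative (\<lambda>h. h *\<^sub>R z)) (at t)" by (auto intro!: derivative_eq_intros)
  from has_derivative_compose[OF this assms] show ?thesis by simp
qed

lemma has_derivative_dilation:
  assumes "(g has_derivative G) (at (r *\<^sub>R x))"
  shows "((\<lambda>x. g (r *\<^sub>R x)) has_derivative (\<lambda>h. r *\<^sub>R G h)) (at x)"
proof -
  have "((\<lambda>x. r *\<^sub>R x) has_derivative (\<lambda>h. r *\<^sub>R h)) (at x)" by (auto intro!: derivative_eq_intros)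
  from has_derivative_compose[OF this assms] show ?thesis
    using has_derivative_linear[OF assms] by (simp add: linear_cmul)
qed

text \<open>Dilation by a factor of modulus below 1 moves the closed ball into the open ball, where
  harmonicity is known. The dilated field is thus differentiable up to the boundary, as the
  divergence theorem demands.\<close>

lemma derivative_dilation_unit_ball:
  fixes g :: "'a::euclidean_space \<Rightarrow> 'a"
  assumes g: "\<And>x. x \<in> ball 0 1 \<Longrightarrow> (g has_derivative H x) (at x)"
    and H: "\<And>b. b \<in> Basis \<Longrightarrow> continuous_on (ball 0 1) (\<lambda>x. H x b)"
    and r: "\<bar>r\<bar> < 1"
  shows "\<And>x. norm x \<le> 1 \<Longrightarrow> ((\<lambda>x. g (r *\<^sub>R x)) has_derivative (\<lambda>h. r *\<^sub>R H (r *\<^sub>R x) h)) (at x)"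
    and "\<And>b. b \<in> Basis \<Longrightarrow> continuous_on (cball 0 1) (\<lambda>x. H (r *\<^sub>R x) b)"
    and "continuous_on (cball 0 1) (\<lambda>x. g (r *\<^sub>R x))"
proof -
  show d: "((\<lambda>x. g (r *\<^sub>R x)) has_derivative (\<lambda>h. r *\<^sub>R H (r *\<^sub>R x) h)) (at x)" if "norm x \<le> 1" for x
    using has_derivative_dilation[OF g[OF scaleR_mem_unit_ball[OF r that]]] .
  show "continuous_on (cball 0 1) (\<lambda>x. H (r *\<^sub>R x) b)" if b: "b \<in> Basis" for b
    by (rule continuous_on_compose2[OF H[OF b]]) (use scaleR_mem_unit_ball[OF r] in \<open>auto intro!: continuous_intros\<close>)
  show "continuous_on (cball 0 1) (\<lambda>x. g (r *\<^sub>R x))"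
    using d by (intro continuous_at_imp_continuous_on ballI) (rule has_derivative_continuous, simp)
qed

text \<open>The radial derivative of the spherical mean is the mean flux of the gradient through the
  sphere. By the divergence theorem this is a multiple of the integral of the Laplacian of the
  dilated function, hence 0.\<close>

theorem harmonic_sphere_mean:
  fixes u :: "'a::euclidean_space \<Rightarrow> real"
  assumes u: "harmonic_on u (ball 0 1)" and r: "\<bar>r\<bar> < 1"
  shows "(\<integral>z. u (r *\<^sub>R z) \<partial>sphere_measure) = u 0"
proof -
  obtain g H where g: "\<And>x. x \<in> ball 0 1 \<Longrightarrow> (u has_derivative (\<lambda>h. g x \<bullet> h)) (at x)"
    and H: "\<And>x. x \<in> ball 0 1 \<Longrightarrow> (g has_derivative H x) (at x)"
    and contH: "\<And>b. b \<in> Basis \<Longrightarrow> continuous_on (ball 0 1) (\<lambda>x. H x b)"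
    and tr: "\<And>x. x \<in> ball 0 1 \<Longrightarrow> (\<Sum>b\<in>Basis. H x b \<bullet> b) = 0"
    and contu: "continuous_on (ball 0 1) u" and contg: "continuous_on (ball 0 1) g"
    by (rule harmonic_onD[OF u]) (rule that)
  define M where "M = (\<lambda>s. \<integral>z. 1 *\<^sub>R u (s *\<^sub>R z) \<partial>(sphere_measure :: 'a measure))"
  have "(M has_real_derivative 0) (at s)" if s: "s \<in> {-1<..<1}" for s
  proof -
    have s1: "\<bar>s\<bar> < 1" using s by auto
    have "(M has_derivative (\<lambda>h. \<integral>z. 1 *\<^sub>R (h * (g (s *\<^sub>R z) \<bullet> z)) \<partial>sphere_measure)) (at s)"
      unfolding M_def
    proof (rule has_derivative_sphere_integral[of "{-1<..<1}"])
      fix t :: real and z :: 'a assume "t \<in> {-1<..<1}" "norm z = 1"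
      then have "t *\<^sub>R z \<in> ball 0 1" by (intro scaleR_mem_unit_ball) auto
      then show "((\<lambda>t. u (t *\<^sub>R z)) has_derivative (\<lambda>h. h * (g (t *\<^sub>R z) \<bullet> z))) (at t)"
        by (intro has_derivative_along_ray g)
    next
      show "continuous_on ({-1<..<1} \<times> sphere 0 1) (\<lambda>(y, z). b * (g (y *\<^sub>R z) \<bullet> z))" for b
        using continuous_on_dilation[OF contg] unfolding case_prod_unfold by (intro continuous_intros)
      show "\<bar>1\<bar> \<le> (1::real)" by simp
    qed (use s continuous_on_dilation[OF contu] in auto)
    also have "(\<lambda>h. \<integral>z. 1 *\<^sub>R (h * (g (s *\<^sub>R z) \<bullet> z)) \<partial>sphere_measure) = (\<lambda>h. 0)"
    proof -
      note dil = derivative_dilation_unit_ball[OF H contH s1]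
      have "(LINT x:ball 0 1|lborel. \<Sum>b\<in>Basis. (s *\<^sub>R H (s *\<^sub>R x) b) \<bullet> b)
        = DIM('a) * measure lborel (ball (0::'a) 1) * (\<integral>z. g (s *\<^sub>R z) \<bullet> z \<partial>sphere_measure)"
        using dil by (intro gauss_unit_ball) (auto intro!: continuous_intros)
      moreover have "(LINT x:ball 0 1|lborel. \<Sum>b\<in>Basis. (s *\<^sub>R H (s *\<^sub>R x) b) \<bullet> b) = (LINT x:ball (0::'a) 1|lborel. 0)"
      proof (intro set_lebesgue_integral_cong allI impI)
        fix x :: 'a assume "x \<in> ball 0 1"
        then have "s *\<^sub>R x \<in> ball 0 1" by (intro scaleR_mem_unit_ball[OF s1]) auto
        from tr[OF this] show "(\<Sum>b\<in>Basis. (s *\<^sub>R H (s *\<^sub>R x) b) \<bullet> b) = 0"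
          by (simp flip: sum_distrib_left)
      qed auto
      ultimately have "(\<integral>z. g (s *\<^sub>R z) \<bullet> z \<partial>sphere_measure) = 0"
        using measure_unit_ball_pos[where 'a='a] by simp
      then show ?thesis by simp
    qed
    finally show ?thesis by (simp add: has_field_derivative_def lambda_zero)
  qed
  then obtain c where c: "\<And>s. s \<in> {-1<..<1} \<Longrightarrow> M s = c"
    using has_field_derivative_zero_constant[OF _ has_field_derivative_at_within, of "{-1<..<1}" M] by auto
  have "M r = M 0" using c[of r] c[of 0] r by (simp add: abs_less_iff)
  then show ?thesis by (simp add: M_def)
qed

text \<open>Two fields lead to the same volume integral of the component of the gradient along
  \<open>c\<close>: one identifies it with the derivative of \<open>L\<close>, the other with
  \<open>L s / s\<close>. So \<open>L s / s\<close> is constant for positive \<open>s\<close>, and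
  its value is found in the limit \<open>s = 0\<close>, where the gradient no longer varies over the
  ball.\<close>

theorem harmonic_sphere_first_moment:
  fixes u :: "'a::euclidean_space \<Rightarrow> real"
  assumes u: "harmonic_on u (ball 0 1)" and r: "0 < r" "r < 1"
    and a: "(u has_derivative (\<lambda>h. a \<bullet> h)) (at 0)"
  shows "(\<integral>z. u (r *\<^sub>R z) * (z \<bullet> c) \<partial>sphere_measure) = r * (a \<bullet> c) / DIM('a)"
proof -
  obtain g H where g: "\<And>x. x \<in> ball 0 1 \<Longrightarrow> (u has_derivative (\<lambda>h. g x \<bullet> h)) (at x)"
    and H: "\<And>x. x \<in> ball 0 1 \<Longrightarrow> (g has_derivative H x) (at x)"
    and contH: "\<And>b. b \<in> Basis \<Longrightarrow> continuous_on (ball 0 1) (\<lambda>x. H x b)"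
    and tr: "\<And>x. x \<in> ball 0 1 \<Longrightarrow> (\<Sum>b\<in>Basis. H x b \<bullet> b) = 0"
    and contu: "continuous_on (ball 0 1) u" and contg: "continuous_on (ball 0 1) g"
    by (rule harmonic_onD[OF u]) (rule that)
  have g0: "g 0 \<bullet> c = a \<bullet> c"
    using has_derivative_unique[OF g[of 0] a] by (auto dest: fun_cong)
  let ?nV = "DIM('a) * measure lborel (ball (0::'a) 1)"
  have nV: "?nV > 0" using measure_unit_ball_pos[where 'a='a] by simp
  define L where "L = (\<lambda>s. \<integral>z. 1 *\<^sub>R (u (s *\<^sub>R z) * (z \<bullet> c)) \<partial>(sphere_measure :: 'a measure))"
  \<comment> \<open>The common value of both computations, written as a volume integral so that at
    \<open>s = 0\<close> its integrand is the constant \<open>g 0 \<bullet> c\<close>.\<close>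
  define L' where "L' = (\<lambda>s. (LINT x:ball 0 1|lborel. g (s *\<^sub>R x) \<bullet> c) / ?nV)"
  have deriv: "(L has_real_derivative L' s) (at s)" if s: "s \<in> {-1<..<1}" for s
  proof -
    have s1: "\<bar>s\<bar> < 1" using s by auto
    note dil = derivative_dilation_unit_ball[OF H contH s1, simplified]
    have "(L has_derivative (\<lambda>h. \<integral>z. 1 *\<^sub>R (h * (g (s *\<^sub>R z) \<bullet> z * (z \<bullet> c))) \<partial>sphere_measure)) (at s)"
      unfolding L_def
    proof (rule has_derivative_sphere_integral[of "{-1<..<1}"])
      fix t :: real and z :: 'a assume "t \<in> {-1<..<1}" "norm z = 1"
      then have "t *\<^sub>R z \<in> ball 0 1" by (intro scaleR_mem_unit_ball) auto
      then have "((\<lambda>t. u (t *\<^sub>R z)) has_derivative (\<lambda>h. h * (g (t *\<^sub>R z) \<bullet> z))) (at t)"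
        by (intro has_derivative_along_ray g)
      then show "((\<lambda>t. u (t *\<^sub>R z) * (z \<bullet> c)) has_derivative (\<lambda>h. h * (g (t *\<^sub>R z) \<bullet> z * (z \<bullet> c)))) (at t)"
        by (auto intro!: derivative_eq_intros)
    next
      show "continuous_on ({-1<..<1} \<times> sphere 0 1) (\<lambda>(y, z). b * (g (y *\<^sub>R z) \<bullet> z * (z \<bullet> c)))" for b
        using continuous_on_dilation[OF contg] unfolding case_prod_unfold by (intro continuous_intros)
      show "continuous_on ({-1<..<1} \<times> sphere 0 1) (\<lambda>(y, z). u (y *\<^sub>R z) * (z \<bullet> c))"
        using continuous_on_dilation[OF contu] unfolding case_prod_unfold by (intro continuous_intros)
      show "\<bar>1\<bar> \<le> (1::real)" by simp
    qed (use s in auto)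
    also have "(\<lambda>h. \<integral>z. 1 *\<^sub>R (h * (g (s *\<^sub>R z) \<bullet> z * (z \<bullet> c))) \<partial>sphere_measure)
        = (\<lambda>h. h * (\<integral>z. g (s *\<^sub>R z) \<bullet> z * (z \<bullet> c) \<partial>sphere_measure))"
      by simp
    also have "(\<integral>z. g (s *\<^sub>R z) \<bullet> z * (z \<bullet> c) \<partial>sphere_measure) = L' s"
    proof -
      \<comment> \<open>The divergence of this field is the gradient component along
        \<open>c\<close> plus a multiple of the Laplacian, which vanishes.\<close>
      have "(LINT x:ball 0 1|lborel. \<Sum>b\<in>Basis. ((b \<bullet> c) *\<^sub>R g (s *\<^sub>R x) + (x \<bullet> c) *\<^sub>R (s *\<^sub>R H (s *\<^sub>R x) b)) \<bullet> b)
        = ?nV * (\<integral>z. ((z \<bullet> c) *\<^sub>R g (s *\<^sub>R z)) \<bullet> z \<partial>sphere_measure)"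
      proof (rule gauss_unit_ball)
        show "((\<lambda>x. (x \<bullet> c) *\<^sub>R g (s *\<^sub>R x)) has_derivative
            (\<lambda>h. (h \<bullet> c) *\<^sub>R g (s *\<^sub>R x) + (x \<bullet> c) *\<^sub>R (s *\<^sub>R H (s *\<^sub>R x) h))) (at x)" if "norm x \<le> 1" for x
          by (rule derivative_eq_intros refl dil(1))+ (simp_all add: that add.commute)
        show "continuous_on (cball 0 1) (\<lambda>x. (b \<bullet> c) *\<^sub>R g (s *\<^sub>R x) + (x \<bullet> c) *\<^sub>R (s *\<^sub>R H (s *\<^sub>R x) b))"
          if "b \<in> Basis" for b
          using dil(2)[OF that] dil(3) by (intro continuous_intros)
      qed
      moreover have "(LINT x:ball 0 1|lborel. \<Sum>b\<in>Basis. ((b \<bullet> c) *\<^sub>R g (s *\<^sub>R x) + (x \<bullet> c) *\<^sub>R (s *\<^sub>R H (s *\<^sub>R x) b)) \<bullet> b)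
          = (LINT x:ball 0 1|lborel. g (s *\<^sub>R x) \<bullet> c)"
      proof (intro set_lebesgue_integral_cong allI impI)
        fix x :: 'a assume "x \<in> ball 0 1"
        then have sx: "s *\<^sub>R x \<in> ball 0 1" by (intro scaleR_mem_unit_ball[OF s1]) auto
        have "(\<Sum>b\<in>Basis. ((b \<bullet> c) *\<^sub>R g (s *\<^sub>R x) + (x \<bullet> c) *\<^sub>R (s *\<^sub>R H (s *\<^sub>R x) b)) \<bullet> b)
          = (\<Sum>b\<in>Basis. (g (s *\<^sub>R x) \<bullet> b) * (c \<bullet> b)) + (x \<bullet> c) * (s * (\<Sum>b\<in>Basis. H (s *\<^sub>R x) b \<bullet> b))"
          by (simp add: inner_add_left sum.distrib sum_distrib_left inner_commute[of c] ac_simps)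
        then show "(\<Sum>b\<in>Basis. ((b \<bullet> c) *\<^sub>R g (s *\<^sub>R x) + (x \<bullet> c) *\<^sub>R (s *\<^sub>R H (s *\<^sub>R x) b)) \<bullet> b) = g (s *\<^sub>R x) \<bullet> c"
          by (simp add: tr[OF sx] euclidean_inner[of "g (s *\<^sub>R x)" c])
      qed auto
      ultimately have "(LINT x:ball 0 1|lborel. g (s *\<^sub>R x) \<bullet> c)
          = ?nV * (\<integral>z. g (s *\<^sub>R z) \<bullet> z * (z \<bullet> c) \<partial>sphere_measure)"
        by (simp only: inner_scaleR_left mult.commute)
      then show ?thesis unfolding L'_def using nV by simp
    qed
    finally show ?thesis by (simp add: has_field_derivative_def mult_commute_abs)
  qed
  have L_eq: "L s = s * L' s" if s: "s \<in> {-1<..<1}" for s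
  proof -
    have s1: "\<bar>s\<bar> < 1" using s by auto
    \<comment> \<open>The direction \<open>c\<close> is constant, so the divergence of this field is
      \<open>s\<close> times the same gradient component; this extra \<open>s\<close> is the one in
      \<open>L s = s * L' s\<close>.\<close>
    have "(LINT x:ball 0 1|lborel. \<Sum>b\<in>Basis. ((s * (g (s *\<^sub>R x) \<bullet> b)) *\<^sub>R c) \<bullet> b)
        = ?nV * (\<integral>z. (u (s *\<^sub>R z) *\<^sub>R c) \<bullet> z \<partial>sphere_measure)"
    proof (rule gauss_unit_ball)
      fix x :: 'a assume "norm x \<le> 1"
      then have sx: "s *\<^sub>R x \<in> ball 0 1" by (intro scaleR_mem_unit_ball[OF s1])
      have "((\<lambda>x. u (s *\<^sub>R x)) has_derivative (\<lambda>h. s * (g (s *\<^sub>R x) \<bullet> h))) (at x)"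
        using has_derivative_dilation[OF g[OF sx]] by simp
      then show "((\<lambda>x. u (s *\<^sub>R x) *\<^sub>R c) has_derivative (\<lambda>h. (s * (g (s *\<^sub>R x) \<bullet> h)) *\<^sub>R c)) (at x)"
        by (auto intro!: derivative_eq_intros)
    next
      show "continuous_on (cball 0 1) (\<lambda>x. (s * (g (s *\<^sub>R x) \<bullet> b)) *\<^sub>R c)" for b
        using derivative_dilation_unit_ball(3)[OF H contH s1] by (intro continuous_intros)
    qed
    moreover have "(\<Sum>b\<in>Basis. ((s * (g (s *\<^sub>R x) \<bullet> b)) *\<^sub>R c) \<bullet> b) = s * (g (s *\<^sub>R x) \<bullet> c)" for x
      by (simp add: euclidean_inner[of "g (s *\<^sub>R x)" c] sum_distrib_left mult.assoc)
    ultimately show ?thesis using nV by (simp add: L_def L'_def inner_commute field_simps)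
  qed
  have "((\<lambda>s. L s / s) has_real_derivative 0) (at s)" if "s \<in> {0<..<1}" for s
    using that by (auto intro!: derivative_eq_intros deriv simp: L_eq)
  then obtain k where k: "\<And>s. s \<in> {0<..<1} \<Longrightarrow> L s / s = k"
    using has_field_derivative_zero_constant[OF _ has_field_derivative_at_within, of "{0<..<1}" "\<lambda>s. L s / s"] by auto
  \<comment> \<open>Since \<open>L 0 = 0\<close>, the quotient \<open>L s / s\<close> is the
    difference quotient of \<open>L\<close> at 0.\<close>
  have "((\<lambda>s. L s / s) \<longlongrightarrow> L' 0) (at 0)"
    using deriv[of 0] L_eq[of 0] by (simp add: DERIV_def)
  then have "((\<lambda>s. L s / s) \<longlongrightarrow> L' 0) (at_right 0)"
    by (rule tendsto_within_subset) simp
  moreover have "\<forall>\<^sub>F s in at_right 0. L s / s = k"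
    using eventually_at_right_less[of 0] eventually_at_right_real[of 0 1] by (auto elim!: eventually_mono simp: k)
  then have "((\<lambda>s. L s / s) \<longlongrightarrow> k) (at_right 0)" by (rule tendsto_eventually)
  ultimately have "k = L' 0" using tendsto_unique[OF trivial_limit_at_right_real] by metis
  also have "\<dots> = (a \<bullet> c) / DIM('a)"
    using nV g0 by (simp add: L'_def set_lebesgue_integral_def)
  finally show ?thesis
    using k[of r] r by (simp add: L_def field_simps)
qed

section \<open>The Poisson kernel\<close>

text \<open>The classical kernel \<open>(1 - |x|^2) / |x - z|^n\<close>, with the power put on the
  squared distance so that the norm need not be differentiated. The sphere has total mass 1, hence
  there is no surface area factor.\<close>

definition poisson_kernel :: "'a::euclidean_space \<Rightarrow> 'a \<Rightarrow> real" where
  "poisson_kernel x z = (1 - x \<bullet> x) * ((x - z) \<bullet> (x - z)) powr (- real DIM('a) / 2)"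

text \<open>The product rule for \<open>(1 - x \<bullet> x) * q powr a\<close>, where
  \<open>q\<close> has gradient \<open>2 (x - z)\<close>. Leaving the terms unsimplified lets a
  second differentiation match the Hessian below term by term.\<close>

definition poisson_gradient :: "'a::euclidean_space \<Rightarrow> 'a \<Rightarrow> 'a" where
  "poisson_gradient x z =
     (let q = (x - z) \<bullet> (x - z); a = - real DIM('a) / 2
      in (- 2 * q powr a) *\<^sub>R x + ((1 - x \<bullet> x) * (2 * a * q powr (a - 1))) *\<^sub>R (x - z))"

definition poisson_hessian :: "'a::euclidean_space \<Rightarrow> 'a \<Rightarrow> 'a \<Rightarrow> 'a" where
  "poisson_hessian x z h =
     (let q = (x - z) \<bullet> (x - z); a = - real DIM('a) / 2
      in (- 4 * a * q powr (a - 1) * ((x - z) \<bullet> h)) *\<^sub>R x + (- 2 * q powr a) *\<^sub>R h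
         + (- 4 * a * q powr (a - 1) * (x \<bullet> h)
            + (1 - x \<bullet> x) * (4 * a * (a - 1) * q powr (a - 2) * ((x - z) \<bullet> h))) *\<^sub>R (x - z)
         + ((1 - x \<bullet> x) * (2 * a * q powr (a - 1))) *\<^sub>R h)"

lemma has_derivative_dist_powr:
  fixes x z :: "'a::real_inner"
  assumes "x \<noteq> z"
  shows "((\<lambda>x. ((x - z) \<bullet> (x - z)) powr a) has_derivative
    (\<lambda>h. 2 * a * ((x - z) \<bullet> (x - z)) powr (a - 1) * ((x - z) \<bullet> h))) (at x)"
proof -
  let ?q = "(x - z) \<bullet> (x - z)"
  have "((\<lambda>x. (x - z) \<bullet> (x - z)) has_derivative (\<lambda>h. 2 * ((x - z) \<bullet> h))) (at x)"
    by (auto intro!: derivative_eq_intros simp: inner_commute)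
  moreover have "((\<lambda>t. t powr a) has_derivative (\<lambda>h. (a * ?q powr (a - 1)) * h)) (at ?q)"
    using has_real_derivative_powr[of ?q a] assms by (simp add: has_field_derivative_def)
  ultimately have "((\<lambda>x. ((x - z) \<bullet> (x - z)) powr a) has_derivative
      (\<lambda>h. (a * ?q powr (a - 1)) * (2 * ((x - z) \<bullet> h)))) (at x)"
    by (rule has_derivative_compose)
  then show ?thesis by (simp add: ac_simps)
qed

lemma has_derivative_poisson_kernel:
  assumes "x \<noteq> z"
  shows "((\<lambda>x. poisson_kernel x z) has_derivative (\<lambda>h. poisson_gradient x z \<bullet> h)) (at x)"
  unfolding poisson_kernel_def poisson_gradient_def Let_def
  by (rule derivative_eq_intros refl has_derivative_dist_powr[OF assms])+
     (simp add: fun_eq_iff inner_add_left inner_diff_left inner_commute algebra_simps)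

lemma has_derivative_poisson_gradient:
  assumes "x \<noteq> z"
  shows "((\<lambda>x. poisson_gradient x z) has_derivative poisson_hessian x z) (at x)"
  unfolding poisson_gradient_def poisson_hessian_def[abs_def] Let_def
  by (rule derivative_eq_intros refl has_derivative_dist_powr[OF assms])+
     (simp add: fun_eq_iff inner_commute algebra_simps)

text \<open>With \<open>n = - 2 * a\<close> and all powers of \<open>q\<close> reduced to
  \<open>q powr (a - 1)\<close>, the trace becomes a multiple of
  \<open>q - 2 * (x \<bullet> (x - z)) - (1 - x \<bullet> x)\<close>. This bracket equals
  \<open>z \<bullet> z - 1\<close>, so it vanishes exactly because \<open>z\<close> is a unit
  vector.\<close>

lemma trace_poisson_hessian:
  fixes x z :: "'a::euclidean_space"
  assumes "x \<noteq> z" and z: "norm z = 1"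
  shows "(\<Sum>b\<in>Basis. poisson_hessian x z b \<bullet> b) = 0"
proof -
  define q where "q = (x - z) \<bullet> (x - z)"
  define a where "a = - real DIM('a) / 2"
  define w where "w = x - z"
  have q0: "q > 0" using assms by (simp add: q_def)
  have q1: "q powr a = q * q powr (a - 1)" "q powr (a - 1) = q * q powr (a - 2)"
    using q0 by (simp_all add: powr_mult_base)
  have n: "real DIM('a) = - 2 * a" by (simp add: a_def)
  have s1: "(\<Sum>b\<in>Basis. (u \<bullet> b) * (v \<bullet> b)) = u \<bullet> v" for u v :: 'a
    by (simp add: euclidean_inner[of u v])
  have "(\<Sum>b\<in>Basis. poisson_hessian x z b \<bullet> b)
      = (\<Sum>b\<in>Basis. (- 4 * a * q powr (a - 1)) * ((w \<bullet> b) * (x \<bullet> b)) + (- 2 * q powr a)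
         + ((- 4 * a * q powr (a - 1)) * ((x \<bullet> b) * (w \<bullet> b))
            + ((1 - x \<bullet> x) * (4 * a * (a - 1) * q powr (a - 2))) * ((w \<bullet> b) * (w \<bullet> b)))
         + (1 - x \<bullet> x) * (2 * a * q powr (a - 1)))"
  proof (intro sum.cong refl)
    fix b :: 'a assume b: "b \<in> Basis"
    have "poisson_hessian x z b = (- 4 * a * q powr (a - 1) * (w \<bullet> b)) *\<^sub>R x + (- 2 * q powr a) *\<^sub>R b
         + (- 4 * a * q powr (a - 1) * (x \<bullet> b)
            + (1 - x \<bullet> x) * (4 * a * (a - 1) * q powr (a - 2) * (w \<bullet> b))) *\<^sub>R w
         + ((1 - x \<bullet> x) * (2 * a * q powr (a - 1))) *\<^sub>R b"
      by (simp only: poisson_hessian_def Let_def q_def a_def w_def)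
    then show "poisson_hessian x z b \<bullet> b
      = (- 4 * a * q powr (a - 1)) * ((w \<bullet> b) * (x \<bullet> b)) + (- 2 * q powr a)
         + ((- 4 * a * q powr (a - 1)) * ((x \<bullet> b) * (w \<bullet> b))
            + ((1 - x \<bullet> x) * (4 * a * (a - 1) * q powr (a - 2))) * ((w \<bullet> b) * (w \<bullet> b)))
         + (1 - x \<bullet> x) * (2 * a * q powr (a - 1))"
      using b by (simp only: inner_add_left inner_scaleR_left inner_same_Basis) (simp add: algebra_simps)
  qed
  also have "\<dots> = (- 4 * a * q powr (a - 1)) * (w \<bullet> x) + real DIM('a) * (- 2 * q powr a)
         + ((- 4 * a * q powr (a - 1)) * (x \<bullet> w)
            + ((1 - x \<bullet> x) * (4 * a * (a - 1) * q powr (a - 2))) * q)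
         + real DIM('a) * ((1 - x \<bullet> x) * (2 * a * q powr (a - 1)))"
    by (simp only: sum.distrib sum_distrib_left[symmetric] s1 sum_constant q_def[folded w_def])
       (simp add: algebra_simps)
  also have "\<dots> = 4 * a * q powr (a - 1) * (q - 2 * (x \<bullet> w) - (1 - x \<bullet> x))"
    unfolding n q1 by (simp add: inner_commute[of w x] algebra_simps)
  also have "q - 2 * (x \<bullet> w) - (1 - x \<bullet> x) = 0"
    using z by (simp add: q_def w_def norm_eq_1 inner_diff_left inner_diff_right inner_commute)
  finally show ?thesis by simp
qed

lemma unit_ball_neq_sphere: "x \<in> ball 0 1 \<Longrightarrow> norm z = 1 \<Longrightarrow> x \<noteq> z"
  by auto

lemma continuous_on_poisson:
  "continuous_on (ball 0 1 \<times> sphere 0 1) (\<lambda>(x, z). poisson_kernel x z)"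
  "continuous_on (ball 0 1 \<times> sphere 0 1) (\<lambda>(x, z). poisson_gradient x z)"
  "continuous_on (ball 0 1 \<times> sphere 0 1) (\<lambda>(x, z). poisson_hessian x z h)"
  unfolding poisson_kernel_def poisson_gradient_def poisson_hessian_def Let_def case_prod_unfold
  by (intro continuous_intros; auto)+

lemma harmonic_on_poisson_kernel:
  fixes z :: "'a::euclidean_space"
  assumes z: "norm z = 1"
  shows "harmonic_on (\<lambda>x. poisson_kernel x z) (ball 0 1)"
  unfolding harmonic_on_def
proof (intro conjI exI ballI)
  fix x :: 'a assume x: "x \<in> ball 0 1"
  show "((\<lambda>x. poisson_kernel x z) has_derivative (\<lambda>h. poisson_gradient x z \<bullet> h)) (at x)"
    "((\<lambda>x. poisson_gradient x z) has_derivative poisson_hessian x z) (at x)"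
    "(\<Sum>b\<in>Basis. poisson_hessian x z b \<bullet> b) = 0"
    using unit_ball_neq_sphere[OF x z] z
    by (auto intro: has_derivative_poisson_kernel has_derivative_poisson_gradient trace_poisson_hessian)
next
  fix b :: 'a
  have "continuous_on (ball 0 1) (\<lambda>x. (\<lambda>(x, z). poisson_hessian x z b) (x, z))"
    by (rule continuous_on_compose2[OF continuous_on_poisson(3)]) (use z in \<open>auto intro!: continuous_intros\<close>)
  then show "continuous_on (ball 0 1) (\<lambda>x. poisson_hessian x z b)" by simp
qed simp

lemma poisson_kernel_pos: "x \<in> ball 0 1 \<Longrightarrow> norm z = 1 \<Longrightarrow> poisson_kernel x z > 0"
  using unit_ball_neq_sphere[of x z] unfolding poisson_kernel_def
  by (auto simp: dot_square_norm power_less_one_iff abs_square_less_1 intro!: mult_pos_pos)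

lemma poisson_kernel_0: "norm z = 1 \<Longrightarrow> poisson_kernel 0 z = 1"
  by (simp add: poisson_kernel_def norm_eq_1)

lemma poisson_gradient_0: "norm z = 1 \<Longrightarrow> poisson_gradient 0 z = DIM('a) *\<^sub>R (z :: 'a::euclidean_space)"
  by (simp add: poisson_gradient_def norm_eq_1)

text \<open>For unit vectors the squared distance between \<open>r e\<close> and \<open>z\<close> is
  \<open>1 - 2 r (e \<bullet> z) + r^2\<close>, which is symmetric in \<open>e\<close> and
  \<open>z\<close>; the numerator depends on \<open>r\<close> alone.\<close>

lemma poisson_kernel_swap:
  assumes "norm e = 1" "norm z = 1"
  shows "poisson_kernel (r *\<^sub>R e) z = poisson_kernel (r *\<^sub>R z) e"
  using assms
  by (simp add: poisson_kernel_def norm_eq_1 inner_diff_left inner_diff_right inner_commute[of e z] algebra_simps)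

text \<open>
  The swap exchanges the roles of the integration variable and of \<open>x / \<parallel>x\<parallel>\<close>, so the mean value
  property in the first argument of the kernel applies.
\<close>

lemma integral_poisson_kernel:
  fixes x :: "'a::euclidean_space"
  assumes x: "x \<in> ball 0 1"
  shows "(\<integral>z. poisson_kernel x z \<partial>sphere_measure) = 1"
proof -
  obtain b :: 'a where b: "norm b = 1" using vector_choose_size[of 1] by auto
  \<comment> \<open>At the origin every unit vector serves as direction, since the factor
    \<open>norm x\<close> is 0.\<close>
  define e where "e = (if x = 0 then b else sgn x)"
  have e: "norm e = 1" "x = norm x *\<^sub>R e" using b by (auto simp: e_def norm_sgn sgn_div_norm)
  have "(\<integral>z. poisson_kernel x z \<partial>sphere_measure) = (\<integral>z. poisson_kernel (norm x *\<^sub>R z) e \<partial>sphere_measure)"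
    using poisson_kernel_swap[OF e(1), of _ "norm x"] e(2)
    by (intro Bochner_Integration.integral_cong) auto
  also have "\<dots> = poisson_kernel 0 e"
    using x by (intro harmonic_sphere_mean harmonic_on_poisson_kernel e) auto
  finally show ?thesis using e by (simp add: poisson_kernel_0)
qed

text \<open>Two differentiations under the integral sign transfer harmonicity from the kernel to the
  integral. The factor \<open>DIM('a)\<close> is that of the gradient \<open>n z\<close> of the
  kernel at the centre.\<close>

lemma harmonic_on_poisson_integral:
  fixes F :: "'a::euclidean_space \<Rightarrow> real"
  assumes F: "F \<in> borel_measurable sphere_measure" "\<And>z. norm z = 1 \<Longrightarrow> \<bar>F z\<bar> \<le> C"
  shows "harmonic_on (\<lambda>x. \<integral>z. F z * poisson_kernel x z \<partial>sphere_measure) (ball 0 1)"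
    and "((\<lambda>x. \<integral>z. F z * poisson_kernel x z \<partial>sphere_measure) has_derivative
      (\<lambda>h. DIM('a) * (\<integral>z. F z * (z \<bullet> h) \<partial>sphere_measure))) (at 0)"
proof -
  have d1: "((\<lambda>x. \<integral>z. F z * poisson_kernel x z \<partial>sphere_measure) has_derivative
      (\<lambda>h. \<integral>z. F z * (poisson_gradient x z \<bullet> h) \<partial>sphere_measure)) (at x)" if "x \<in> ball 0 1" for x
    unfolding real_scaleR_def[symmetric]
  proof (rule has_derivative_sphere_integral[OF open_ball that])
    show "continuous_on (ball 0 1 \<times> sphere 0 1) (\<lambda>(y, z). poisson_gradient y z \<bullet> b)" for b :: 'a
      using continuous_on_poisson(2) unfolding case_prod_unfold by (intro continuous_intros)
    show "((\<lambda>y. poisson_kernel y z) has_derivative (\<lambda>h. poisson_gradient y z \<bullet> h)) (at y)"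
      if "y \<in> ball 0 1" "norm z = 1" for y z :: 'a
      using that by (intro has_derivative_poisson_kernel unit_ball_neq_sphere)
  qed (use F continuous_on_poisson(1) in auto)
  have d2: "((\<lambda>x. \<integral>z. F z *\<^sub>R poisson_gradient x z \<partial>sphere_measure) has_derivative
      (\<lambda>h. \<integral>z. F z *\<^sub>R poisson_hessian x z h \<partial>sphere_measure)) (at x)" if "x \<in> ball 0 1" for x
  proof (rule has_derivative_sphere_integral[OF open_ball that])
    show "((\<lambda>y. poisson_gradient y z) has_derivative poisson_hessian y z) (at y)"
      if "y \<in> ball 0 1" "norm z = 1" for y z :: 'a
      using that by (intro has_derivative_poisson_gradient unit_ball_neq_sphere)
  qed (use F continuous_on_poisson(2,3) in auto)
  show "((\<lambda>x. \<integral>z. F z * poisson_kernel x z \<partial>sphere_measure) has_derivative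
      (\<lambda>h. DIM('a) * (\<integral>z. F z * (z \<bullet> h) \<partial>sphere_measure))) (at 0)"
  proof -
    have "(\<integral>z. F z * (poisson_gradient 0 z \<bullet> h) \<partial>sphere_measure) = (\<integral>z. DIM('a) * (F z * (z \<bullet> h)) \<partial>sphere_measure)" for h
      by (intro Bochner_Integration.integral_cong) (auto simp: poisson_gradient_0)
    then show ?thesis using d1[of 0] by simp
  qed
  show "harmonic_on (\<lambda>x. \<integral>z. F z * poisson_kernel x z \<partial>sphere_measure) (ball 0 1)"
    unfolding harmonic_on_def
  proof (intro conjI exI ballI)
    fix x :: 'a assume x: "x \<in> ball 0 1"
    have "(\<integral>z. F z *\<^sub>R poisson_gradient x z \<partial>sphere_measure) \<bullet> h = (\<integral>z. F z * (poisson_gradient x z \<bullet> h) \<partial>sphere_measure)" for h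
      using integrable_sphere_mult[OF F continuous_on_parametric[OF continuous_on_poisson(2) x]]
      by (subst integral_inner_left[symmetric]) auto
    then show "((\<lambda>x. \<integral>z. F z * poisson_kernel x z \<partial>sphere_measure) has_derivative
      (\<lambda>h. (\<integral>z. F z *\<^sub>R poisson_gradient x z \<partial>sphere_measure) \<bullet> h)) (at x)"
      using d1[OF x] by simp
    show "((\<lambda>x. \<integral>z. F z *\<^sub>R poisson_gradient x z \<partial>sphere_measure) has_derivative
      (\<lambda>h. \<integral>z. F z *\<^sub>R poisson_hessian x z h \<partial>sphere_measure)) (at x)"
      by (rule d2[OF x])
    note int = integrable_sphere_mult[OF F continuous_on_parametric[OF continuous_on_poisson(3) x]]
    have "(\<Sum>b\<in>Basis. (\<integral>z. F z *\<^sub>R poisson_hessian x z b \<partial>sphere_measure) \<bullet> b)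
        = (\<integral>z. (\<Sum>b\<in>Basis. (F z *\<^sub>R poisson_hessian x z b) \<bullet> b) \<partial>sphere_measure)"
      using int by (subst Bochner_Integration.integral_sum) (auto simp del: inner_scaleR_left)
    also have "\<dots> = (\<integral>z. 0 \<partial>(sphere_measure :: 'a measure))"
      using trace_poisson_hessian[OF unit_ball_neq_sphere[OF x]]
      by (intro Bochner_Integration.integral_cong) (auto simp flip: sum_distrib_left)
    finally show "(\<Sum>b\<in>Basis. (\<integral>z. F z *\<^sub>R poisson_hessian x z b \<partial>sphere_measure) \<bullet> b) = 0" by simp
  next
    fix b :: 'a
    show "continuous_on (ball 0 1) (\<lambda>x. \<integral>z. F z *\<^sub>R poisson_hessian x z b \<partial>sphere_measure)"
      by (rule continuous_on_sphere_integral[OF continuous_on_poisson(3) F])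
  qed simp
qed

section \<open>Poisson integrals of bounded vector fields\<close>

lemma integrable_poisson_kernel_scaleR:
  fixes F :: "'a::euclidean_space \<Rightarrow> 'b::euclidean_space"
  assumes F: "F \<in> borel_measurable borel" and bound: "\<And>z. norm (F z) \<le> 1" and x: "x \<in> ball 0 1"
  shows "integrable sphere_measure (\<lambda>z. poisson_kernel x z *\<^sub>R F z)"
proof (rule Bochner_Integration.integrable_bound)
  have cont: "continuous_on (sphere 0 1) (poisson_kernel x)"
    by (rule continuous_on_parametric[OF continuous_on_poisson(1) x])
  show "integrable sphere_measure (poisson_kernel x)"
    using cont by (rule integrable_sphere_continuous)
  show "(\<lambda>z. poisson_kernel x z *\<^sub>R F z) \<in> borel_measurable sphere_measure"
    by (intro borel_measurable_scaleR borel_measurable_sphere[OF F] borel_measurable_sphere_continuous cont)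
  show "AE z in sphere_measure. norm (poisson_kernel x z *\<^sub>R F z) \<le> norm (poisson_kernel x z)"
    using bound by (intro AE_I2) (simp add: mult_left_le)
qed

text \<open>The total mass of the kernel alone yields the bound 1 without strictness. The gain is
  the minimum of the kernel over the sphere, which is attained by compactness and therefore
  positive.\<close>

lemma norm_poisson_integral_less_1:
  fixes F :: "'a::euclidean_space \<Rightarrow> 'b::euclidean_space"
  assumes F: "F \<in> borel_measurable borel" and bound: "\<And>z. norm (F z) \<le> 1"
    and odd: "\<And>z. F (- z) = - F z" and x: "x \<in> ball 0 1"
  shows "norm (\<integral>z. poisson_kernel x z *\<^sub>R F z \<partial>sphere_measure) < 1"
proof -
  have cont: "continuous_on (sphere 0 1) (poisson_kernel x)"
    by (rule continuous_on_parametric[OF continuous_on_poisson(1) x])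
  obtain b :: 'a where "norm b = 1" using vector_choose_size[of 1] by auto
  then have "sphere (0::'a) 1 \<noteq> {}" by auto
  then obtain z0 where z0: "norm z0 = 1" and min: "\<And>z. norm z = 1 \<Longrightarrow> poisson_kernel x z0 \<le> poisson_kernel x z"
    using continuous_attains_inf[OF compact_sphere _ cont] by auto
  define c where "c = poisson_kernel x z0"
  have c: "c > 0" unfolding c_def by (rule poisson_kernel_pos[OF x z0])
  have Fm: "F \<in> borel_measurable sphere_measure" using F by (rule borel_measurable_sphere)
  have intF: "integrable sphere_measure F"
    using Fm bound by (rule integrable_sphere_bounded)
  have F0: "(\<integral>z. F z \<partial>sphere_measure) = 0"
    using F odd by (rule integral_sphere_odd)
  have intP: "integrable sphere_measure (poisson_kernel x)"
    using cont by (rule integrable_sphere_continuous)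
  note intPF = integrable_poisson_kernel_scaleR[OF F bound x]
  \<comment> \<open>\<open>F\<close> has mean 0, so the positive constant \<open>c\<close> can be subtracted from the kernel.\<close>
  have "(\<integral>z. poisson_kernel x z *\<^sub>R F z \<partial>sphere_measure) = (\<integral>z. (poisson_kernel x z - c) *\<^sub>R F z \<partial>sphere_measure)"
    using intPF intF F0 by (simp add: scaleR_diff_left)
  also have "norm \<dots> \<le> (\<integral>z. poisson_kernel x z - c \<partial>sphere_measure)"
  proof (rule Bochner_Integration.integral_norm_bound_integral)
    show "integrable sphere_measure (\<lambda>z. (poisson_kernel x z - c) *\<^sub>R F z)"
      using intPF intF by (simp add: scaleR_diff_left)
    show "integrable sphere_measure (\<lambda>z. poisson_kernel x z - c)" using intP by simp
    show "norm ((poisson_kernel x z - c) *\<^sub>R F z) \<le> poisson_kernel x z - c" if "z \<in> space sphere_measure" for z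
      using min[of z] bound[of z] that by (simp add: c_def mult_left_le)
  qed
  also have "\<dots> = 1 - c"
    using intP integral_poisson_kernel[OF x] by simp
  finally show ?thesis using c by simp
qed

section \<open>The Hardy norm\<close>

lemma matrix_inner_eq: "matrix_inner A B = (A \<bullet> B) / CARD('n)" for A B :: "real^'n^'n"
proof -
  have "trace (transpose B ** A) = (\<Sum>j\<in>UNIV. \<Sum>i\<in>UNIV. A $ i $ j * B $ i $ j)"
    by (simp add: trace_def matrix_matrix_mult_def transpose_def mult.commute)
  also have "\<dots> = A \<bullet> B"
    by (subst sum.swap) (simp add: inner_vec_def)
  finally show ?thesis by (simp add: matrix_inner_def)
qed

lemma matrix_inner_add_right: "matrix_inner A (B + C) = matrix_inner A B + matrix_inner A C"
  and matrix_inner_scaleR_right: "matrix_inner A (r *\<^sub>R B) = r * matrix_inner A B"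
  for A B :: "real^'n^'n"
  by (simp_all add: matrix_inner_eq inner_add_right add_divide_distrib)

lemma continuous_on_matrix_vector_mult:
  fixes B :: "'p::topological_space \<Rightarrow> real^'n^'m"
  assumes "continuous_on S B" "continuous_on S z"
  shows "continuous_on S (\<lambda>p. B p *v z p)"
  unfolding matrix_vector_mult_def using assms by (intro continuous_intros)

lemma integrable_norm_matrix: "integrable sphere_measure (\<lambda>z. norm (B *v z))" for B :: "real^'n^'n"
  by (intro integrable_sphere_continuous continuous_on_norm continuous_on_matrix_vector_mult continuous_intros)

lemma continuous_on_hardy_norm: "continuous_on S (hardy_norm :: real^'n^'n \<Rightarrow> real)"
proof -
  have "continuous_on S (\<lambda>B. \<integral>z. 1 *\<^sub>R norm (B *v z) \<partial>(sphere_measure :: (real^'n) measure))"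
  proof (rule continuous_on_sphere_integral)
    show "continuous_on (S \<times> sphere 0 1) (\<lambda>(B :: real^'n^'n, z). norm (B *v z))"
      unfolding case_prod_unfold by (intro continuous_intros continuous_on_matrix_vector_mult)
  qed auto
  then show ?thesis by (simp add: hardy_norm_def[abs_def])
qed

lemma hardy_norm_scaleR: "hardy_norm (r *\<^sub>R B) = \<bar>r\<bar> * hardy_norm B"
  by (simp add: hardy_norm_def scaleR_matrix_vector_assoc[symmetric])

text \<open>Some row of \<open>B\<close> is nonzero, so the kernel of \<open>B\<close> lies in a
  hyperplane through the origin. That hyperplane is Lebesgue null and consists of full lines, so its
  trace on the sphere is null for the cone measure.\<close>

lemma AE_sphere_matrix_neq_0:
  fixes B :: "real^'n^'n"
  assumes "B \<noteq> 0"
  shows "AE z in sphere_measure. B *v z \<noteq> 0"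
proof (rule AE_sphere_measureI)
  obtain i where i: "B $ i \<noteq> 0" using assms by (auto simp: vec_eq_iff)
  have "{x. B $ i \<bullet> x = 0} \<in> null_sets (completion lborel)"
    using negligible_hyperplane[of "B $ i" 0] i by (simp add: negligible_iff_null_sets)
  then have "{x. B $ i \<bullet> x = 0} \<in> null_sets lborel"
    by (subst (asm) null_sets_completion_iff) (auto intro!: borel_closed closed_hyperplane)
  then have "AE x in lborel. x \<notin> {x. B $ i \<bullet> x = 0}" by (rule AE_not_in)
  then show "AE x in lborel. x \<noteq> 0 \<longrightarrow> B *v sgn x \<noteq> 0"
  proof eventually_elim
    case (elim x)
    have "(B *v sgn x) $ i = (B $ i \<bullet> x) / norm x"
      by (simp add: matrix_vector_mul_component sgn_div_norm divide_inverse mult.commute)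
    then have "x \<noteq> 0 \<longrightarrow> (B *v sgn x) $ i \<noteq> 0" using elim by simp
    then show ?case by auto
  qed
  have "continuous_on UNIV (\<lambda>z. B *v z)"
    by (intro continuous_on_matrix_vector_mult continuous_intros)
  then have "closed ((\<lambda>z. B *v z) -` {0})"
    by (intro closed_vimage) auto
  then show "Measurable.pred borel (\<lambda>z. B *v z \<noteq> 0)"
    by (intro pred_intros_logic) (auto simp: pred_def vimage_def intro!: borel_closed)
qed

text \<open>Norm 0 would force \<open>B z = 0\<close> almost everywhere, against total mass 1.
  Positivity is what makes the quotient in the extremal problem continuous.\<close>

lemma hardy_norm_pos:
  fixes B :: "real^'n^'n"
  assumes "B \<noteq> 0"
  shows "hardy_norm B > 0"
proof -
  have "hardy_norm B \<ge> 0" unfolding hardy_norm_def by (intro Bochner_Integration.integral_nonneg) simp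
  moreover have "hardy_norm B \<noteq> 0"
  proof
    assume "hardy_norm B = 0"
    then have "AE z in sphere_measure. norm (B *v z) = 0"
      using integral_nonneg_eq_0_iff_AE[OF integrable_norm_matrix[of B]] by (auto simp: hardy_norm_def)
    with AE_sphere_matrix_neq_0[OF assms] have "AE z in sphere_measure :: (real^'n) measure. False"
      by eventually_elim simp
    then show False
      using emeasure_sphere_measure_total[where 'a="real^'n"] by (simp add: eventually_False ae_filter_eq_bot_iff)
  qed
  ultimately show ?thesis by simp
qed

text \<open>The Euclidean norm is differentiable at \<open>B z\<close> for almost every
  \<open>z\<close>, and the difference quotients are dominated by \<open>norm (C z)\<close>, so the
  limit passes through the integral.\<close>

lemma hardy_norm_directional_derivative:
  fixes B C :: "real^'n^'n"
  assumes "B \<noteq> 0"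
  shows "((\<lambda>s. hardy_norm (B + s *\<^sub>R C)) has_real_derivative
    (\<integral>z. sgn (B *v z) \<bullet> (C *v z) \<partial>sphere_measure)) (at 0)"
  unfolding DERIV_def tendsto_at_iff_sequentially
proof (intro allI impI)
  fix s :: "nat \<Rightarrow> real"
  assume s: "\<forall>k. s k \<in> UNIV - {0}" and lim: "s \<longlonglongrightarrow> 0"
  let ?d = "\<lambda>k z. (norm (B *v z + s k *\<^sub>R (C *v z)) - norm (B *v z)) / s k"
  have cont: "continuous_on UNIV (\<lambda>z. D *v z)" for D :: "real^'n^'n"
    by (intro continuous_on_matrix_vector_mult continuous_intros)
  have "(\<lambda>k. \<integral>z. ?d k z \<partial>sphere_measure) \<longlonglongrightarrow> (\<integral>z. sgn (B *v z) \<bullet> (C *v z) \<partial>sphere_measure)"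
  proof (rule integral_dominated_convergence[where w="\<lambda>z. norm (C *v z)"])
    have "(\<lambda>z. sgn (B *v z) \<bullet> (C *v z)) \<in> borel_measurable borel"
      by (intro borel_measurable_inner borel_measurable_continuous_onI[OF cont]
          measurable_compose[OF borel_measurable_continuous_onI[OF cont] borel_measurable_sgn])
    then show "(\<lambda>z. sgn (B *v z) \<bullet> (C *v z)) \<in> borel_measurable sphere_measure"
      by (rule borel_measurable_sphere)
    show "?d k \<in> borel_measurable sphere_measure" for k
      by (intro borel_measurable_sphere_continuous continuous_intros continuous_on_subset[OF cont])
         (use s in auto)
    show "AE z in sphere_measure. norm (?d k z) \<le> norm (C *v z)" for k
    proof (rule AE_I2)
      fix z
      have "\<bar>norm (B *v z + s k *\<^sub>R (C *v z)) - norm (B *v z)\<bar> \<le> norm (s k *\<^sub>R (C *v z))"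
        using norm_triangle_ineq3[of "B *v z + s k *\<^sub>R (C *v z)" "B *v z"] by simp
      then show "norm (?d k z) \<le> norm (C *v z)" using s by (simp add: divide_le_eq mult.commute)
    qed
    show "AE z in sphere_measure. (\<lambda>k. ?d k z) \<longlonglongrightarrow> sgn (B *v z) \<bullet> (C *v z)"
      using AE_sphere_matrix_neq_0[OF assms]
    proof eventually_elim
      case (elim z)
      have "((\<lambda>t. norm (B *v z + t *\<^sub>R (C *v z))) has_real_derivative (sgn (B *v z) \<bullet> (C *v z))) (at 0)"
        using has_derivative_imp_directional[OF has_derivative_norm[OF elim], of "C *v z"]
        by (simp add: inner_commute)
      then have "((\<lambda>t. (norm (B *v z + t *\<^sub>R (C *v z)) - norm (B *v z)) / t) \<circ> s) \<longlonglongrightarrow> sgn (B *v z) \<bullet> (C *v z)"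
        using s lim unfolding DERIV_def tendsto_at_iff_sequentially by simp
      then show ?case by (simp add: comp_def)
    qed
  qed (rule integrable_norm_matrix)
  moreover have "(\<integral>z. ?d k z \<partial>sphere_measure) = (hardy_norm (B + s k *\<^sub>R C) - hardy_norm B) / s k" for k
    using integrable_norm_matrix[of "B + s k *\<^sub>R C"] integrable_norm_matrix[of B]
    by (simp add: hardy_norm_def matrix_vector_mult_add_rdistrib scaleR_matrix_vector_assoc[symmetric])
  ultimately have "(\<lambda>k. (hardy_norm (B + s k *\<^sub>R C) - hardy_norm B) / s k)
      \<longlonglongrightarrow> (\<integral>z. sgn (B *v z) \<bullet> (C *v z) \<partial>sphere_measure)"
    by (simp only:)
  then show "((\<lambda>t. (hardy_norm (B + (0 + t) *\<^sub>R C) - hardy_norm (B + 0 *\<^sub>R C)) / t) \<circ> s)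
      \<longlonglongrightarrow> (\<integral>z. sgn (B *v z) \<bullet> (C *v z) \<partial>sphere_measure)"
    by (simp add: comp_def)
qed

text \<open>The quotient attains its maximum on the compact Euclidean unit sphere of matrices, and
  homogeneity carries the resulting inequality to all matrices. Differentiability of the Hardy norm
  at the maximiser turns the inequality into an equation in every direction.\<close>

lemma hardy_extremal:
  fixes A :: "real^'n^'n"
  assumes A: "hardy_dual_norm A \<le> 1"
  obtains B t where "0 \<le> t" "t \<le> 1"
    "\<And>C. matrix_inner A C = t * (\<integral>z. sgn (B *v z) \<bullet> (C *v z) \<partial>sphere_measure)"
proof -
  define \<rho> where "\<rho> = (\<lambda>B. matrix_inner A B / hardy_norm B)"
  have "continuous_on (sphere 0 1) \<rho>"
    unfolding \<rho>_def matrix_inner_eq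
  proof (intro continuous_intros continuous_on_hardy_norm ballI)
    fix B :: "real^'n^'n" assume "B \<in> sphere 0 1"
    then have "B \<noteq> 0" by auto
    then show "hardy_norm B \<noteq> 0" using hardy_norm_pos[of B] by simp
  qed simp
  moreover obtain B1 :: "real^'n^'n" where "norm B1 = 1" using vector_choose_size[of 1] by auto
  then have "sphere (0 :: real^'n^'n) 1 \<noteq> {}" by auto
  ultimately obtain B where B: "norm B = 1" and max: "\<And>C. norm C = 1 \<Longrightarrow> \<rho> C \<le> \<rho> B"
    using continuous_attains_sup[OF compact_sphere, of 0 1 \<rho>] by auto
  define t where "t = \<rho> B"
  have B0: "B \<noteq> 0" using B by auto
  note NB = hardy_norm_pos[OF B0]
  have le: "matrix_inner A C \<le> t * hardy_norm C" for C
  proof (cases "C = 0")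
    case True
    then show ?thesis using hardy_norm_scaleR[of 0 C] matrix_inner_scaleR_right[of A 0 C] by simp
  next
    case False
    define D where "D = (1 / norm C) *\<^sub>R C"
    have D: "norm D = 1" "C = norm C *\<^sub>R D" using False by (simp_all add: D_def)
    have "hardy_norm D > 0" using D(1) by (intro hardy_norm_pos) auto
    then have "matrix_inner A D \<le> t * hardy_norm D"
      using max[OF D(1)] unfolding t_def[symmetric] by (simp add: \<rho>_def pos_divide_le_eq)
    then have "norm C * matrix_inner A D \<le> norm C * (t * hardy_norm D)" by (intro mult_left_mono) auto
    then show ?thesis
      by (subst (1 2) D(2)) (simp add: matrix_inner_scaleR_right hardy_norm_scaleR ac_simps)
  qed
  have eq: "matrix_inner A B = t * hardy_norm B" using NB by (simp add: t_def \<rho>_def)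
  \<comment> \<open>The inequality is tested at \<open>- B\<close>, whose Hardy norm is the
    same.\<close>
  have t0: "0 \<le> t"
  proof -
    have "- matrix_inner A B \<le> t * hardy_norm B"
      using le[of "(-1) *\<^sub>R B"] unfolding matrix_inner_scaleR_right hardy_norm_scaleR by simp
    then have "0 \<le> t * hardy_norm B" using eq by linarith
    then show ?thesis using NB by (simp add: zero_le_mult_iff)
  qed
  \<comment> \<open>Comparing with a real supremum requires boundedness, which \<open>le\<close>
    provides. The value \<open>t\<close> itself is taken at \<open>B\<close> divided by its Hardy
    norm.\<close>
  have t1: "t \<le> 1"
  proof -
    let ?S = "{matrix_inner A B | B. hardy_norm B \<le> 1}"
    have "bdd_above ?S"
    proof (rule bdd_aboveI)
      fix y assume "y \<in> ?S"
      then obtain C where "y = matrix_inner A C" "hardy_norm C \<le> 1" by auto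
      then show "y \<le> t" using le[of C] mult_left_mono[OF _ t0, of "hardy_norm C" 1] by simp
    qed
    moreover have "t \<in> ?S"
    proof -
      have "t = matrix_inner A ((1 / hardy_norm B) *\<^sub>R B)" "hardy_norm ((1 / hardy_norm B) *\<^sub>R B) \<le> 1"
        unfolding matrix_inner_scaleR_right hardy_norm_scaleR eq using NB by simp_all
      then show ?thesis by blast
    qed
    ultimately have "t \<le> Sup ?S" by (intro cSup_upper)
    then show ?thesis using A by (simp add: hardy_dual_norm_def)
  qed
  have "matrix_inner A C = t * (\<integral>z. sgn (B *v z) \<bullet> (C *v z) \<partial>sphere_measure)" for C
  proof -
    \<comment> \<open>The slack of the inequality \<open>le\<close> along a line through
      \<open>B\<close>. It is nonnegative and vanishes at \<open>s = 0\<close>, an interior minimum,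
      so its derivative there is 0.\<close>
    define \<phi> where "\<phi> = (\<lambda>s. t * hardy_norm (B + s *\<^sub>R C) - matrix_inner A (B + s *\<^sub>R C))"
    have "(\<phi> has_real_derivative (t * (\<integral>z. sgn (B *v z) \<bullet> (C *v z) \<partial>sphere_measure) - matrix_inner A C)) (at 0)"
      unfolding \<phi>_def matrix_inner_add_right matrix_inner_scaleR_right
      by (auto intro!: derivative_eq_intros hardy_norm_directional_derivative[OF B0])
    moreover have "\<phi> 0 \<le> \<phi> s" for s
      using le[of "B + s *\<^sub>R C"] eq by (simp add: \<phi>_def)
    ultimately have "t * (\<integral>z. sgn (B *v z) \<bullet> (C *v z) \<partial>sphere_measure) - matrix_inner A C = 0"
      by (intro DERIV_local_min[where d=1]) auto
    then show ?thesis by simp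
  qed
  then show ?thesis using t0 t1 that by blast
qed

section \<open>The Schwarz lemma\<close>

lemma hardy_dual_norm_le_1_if_harmonic:
  fixes A :: "real^'n^'n"
  assumes f: "harmonic_self_map_ball f" and deriv: "(f has_derivative (*v) A) (at 0)"
  shows "hardy_dual_norm A \<le> 1"
proof -
  have harm: "harmonic_on (\<lambda>x. f x $ i) (ball 0 1)" for i
    using f by (simp add: harmonic_self_map_ball_def)
  have bound: "norm (f x) \<le> 1" if "x \<in> ball 0 1" for x
    using f that by (auto simp: harmonic_self_map_ball_def image_subset_iff less_imp_le)
  have di: "((\<lambda>x. f x $ i) has_derivative (\<lambda>h. A $ i \<bullet> h)) (at 0)" for i
    using bounded_linear.has_derivative[OF bounded_linear_vec_nth deriv, of i]
    by (simp add: matrix_vector_mul_component)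
  have "matrix_inner A B \<le> 1" if B: "hardy_norm B \<le> 1" for B :: "real^'n^'n"
  proof -
    \<comment> \<open>\<open>f\<close> has no prescribed boundary values, so the estimate is made on
      spheres of radius \<open>r < 1\<close>, and only the resulting scalar inequality is passed to
      the limit. Row \<open>i\<close> of \<open>B\<close> acts as the vector \<open>c\<close> in the
      first moment of component \<open>i\<close>.\<close>
    have le: "r * matrix_inner A B \<le> 1" if r: "r \<in> {0<..<1}" for r
    proof -
      have "continuous_on (sphere 0 1) (\<lambda>z. f (r *\<^sub>R z) $ i)" for i
      proof -
        have "continuous_on (ball 0 1) (\<lambda>x. f x $ i)" by (rule harmonic_onD[OF harm[of i]])
        then show ?thesis
          by (rule continuous_on_compose2) (use r in \<open>auto intro!: continuous_intros\<close>)
      qed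
      then have "continuous_on (sphere 0 1) (\<lambda>z. \<chi> i. f (r *\<^sub>R z) $ i)"
        by (rule continuous_on_vec_lambda)
      then have contf: "continuous_on (sphere 0 1) (\<lambda>z. f (r *\<^sub>R z))" by simp
      have "(\<integral>z. f (r *\<^sub>R z) \<bullet> (B *v z) \<partial>sphere_measure)
          = (\<integral>z. (\<Sum>i\<in>UNIV. f (r *\<^sub>R z) $ i * (z \<bullet> B $ i)) \<partial>sphere_measure)"
      proof (intro Bochner_Integration.integral_cong refl)
        fix z
        show "f (r *\<^sub>R z) \<bullet> (B *v z) = (\<Sum>i\<in>UNIV. f (r *\<^sub>R z) $ i * (z \<bullet> B $ i))"
          unfolding inner_vec_def[of "f (r *\<^sub>R z)"] by (simp add: matrix_vector_mul_component inner_commute)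
      qed
      also have "\<dots> = (\<Sum>i\<in>UNIV. \<integral>z. f (r *\<^sub>R z) $ i * (z \<bullet> B $ i) \<partial>sphere_measure)"
        using contf by (intro Bochner_Integration.integral_sum integrable_sphere_continuous continuous_intros)
      also have "\<dots> = (\<Sum>i\<in>UNIV. r * (A $ i \<bullet> B $ i) / CARD('n))"
        using r harmonic_sphere_first_moment[OF harm _ _ di] by simp
      also have "\<dots> = r * matrix_inner A B"
        by (simp add: matrix_inner_eq inner_vec_def[of A] sum_distrib_left sum_divide_distrib)
      finally have "r * matrix_inner A B = (\<integral>z. f (r *\<^sub>R z) \<bullet> (B *v z) \<partial>sphere_measure)" ..
      also have "\<dots> \<le> (\<integral>z. norm (B *v z) \<partial>sphere_measure)"
      proof (rule integral_mono[OF _ integrable_norm_matrix])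
        show "integrable sphere_measure (\<lambda>z. f (r *\<^sub>R z) \<bullet> (B *v z))"
          by (intro integrable_sphere_continuous continuous_on_inner contf continuous_on_matrix_vector_mult
              continuous_on_const continuous_on_id)
        fix z :: "real^'n" assume "z \<in> space sphere_measure"
        then have "r *\<^sub>R z \<in> ball 0 1" using r by (intro scaleR_mem_unit_ball) auto
        then have "norm (f (r *\<^sub>R z)) * norm (B *v z) \<le> 1 * norm (B *v z)"
          by (intro mult_right_mono bound) auto
        then show "f (r *\<^sub>R z) \<bullet> (B *v z) \<le> norm (B *v z)"
          using norm_cauchy_schwarz[of "f (r *\<^sub>R z)" "B *v z"] by linarith
      qed
      also have "\<dots> \<le> 1" using B by (simp add: hardy_norm_def)
      finally show ?thesis .
    qed
    have "((\<lambda>r. r * matrix_inner A B) \<longlongrightarrow> 1 * matrix_inner A B) (at_left 1)"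
      by (intro tendsto_intros)
    moreover have "\<forall>\<^sub>F r in at_left 1. r * matrix_inner A B \<le> 1"
      using eventually_at_left_real[of 0 1] le by (auto elim: eventually_mono)
    ultimately show ?thesis using tendsto_upperbound by fastforce
  qed
  \<comment> \<open>The zero matrix makes the set under the supremum nonempty.\<close>
  moreover have "hardy_norm (0 :: real^'n^'n) \<le> 1" by (simp add: hardy_norm_def)
  ultimately show ?thesis
    unfolding hardy_dual_norm_def by (intro cSup_least) auto
qed

lemma harmonic_if_hardy_dual_norm_le_1:
  fixes A :: "real^'n^'n"
  assumes A: "hardy_dual_norm A \<le> 1"
  obtains f where "harmonic_self_map_ball f" "f 0 = 0" "(f has_derivative (*v) A) (at 0)"
proof -
  obtain B :: "real^'n^'n" and t where t: "0 \<le> t" "t \<le> 1"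
    and ext: "\<And>C. matrix_inner A C = t * (\<integral>z. sgn (B *v z) \<bullet> (C *v z) \<partial>sphere_measure)"
    using hardy_extremal[OF A] by metis
  \<comment> \<open>Because \<open>sgn 0 = 0\<close>, the field is odd everywhere, including on the
    kernel of \<open>B\<close>.\<close>
  define F :: "real^'n \<Rightarrow> real^'n" where "F = (\<lambda>z. sgn (B *v z))"
  have "continuous_on UNIV (\<lambda>z. B *v z)"
    by (intro continuous_on_matrix_vector_mult continuous_intros)
  then have F: "F \<in> borel_measurable borel"
    unfolding F_def by (intro measurable_compose[OF borel_measurable_continuous_onI borel_measurable_sgn])
  have bound: "norm (F z) \<le> 1" for z by (simp add: F_def norm_sgn)
  have odd: "F (- z) = - F z" for z
    by (simp add: F_def sgn_minus linear_neg[OF matrix_vector_mul_linear])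
  have Fm: "(\<lambda>z. t * F z $ i) \<in> borel_measurable sphere_measure" for i
    by (intro borel_measurable_sphere measurable_compose[OF F] borel_measurable_continuous_onI continuous_intros)
  have Fb: "\<bar>t * F z $ i\<bar> \<le> 1" for i z
    using mult_mono'[of t 1 "\<bar>F z $ i\<bar>" 1] t bound[of z] component_le_norm_cart[of "F z" i] by (simp add: abs_mult)
  define f where "f = (\<lambda>x. t *\<^sub>R (\<integral>z. poisson_kernel x z *\<^sub>R F z \<partial>sphere_measure))"
  note int = integrable_poisson_kernel_scaleR[OF F bound]
  have fi: "f x $ i = (\<integral>z. (t * F z $ i) * poisson_kernel x z \<partial>sphere_measure)" if "x \<in> ball 0 1" for x i
  proof -
    have "(\<integral>z. poisson_kernel x z *\<^sub>R F z \<partial>sphere_measure) $ i = (\<integral>z. (poisson_kernel x z *\<^sub>R F z) $ i \<partial>sphere_measure)"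
      using integral_bounded_linear[OF bounded_linear_vec_nth int[OF that], of i] by simp
    then show ?thesis by (simp add: f_def ac_simps)
  qed
  have "harmonic_self_map_ball f"
    unfolding harmonic_self_map_ball_def
  proof (intro conjI allI)
    show "f ` ball 0 1 \<subseteq> ball 0 1"
    proof clarify
      fix x :: "real^'n" assume "x \<in> ball 0 1"
      then have "norm (\<integral>z. poisson_kernel x z *\<^sub>R F z \<partial>sphere_measure) < 1"
        using F bound odd by (intro norm_poisson_integral_less_1)
      then have "t * norm (\<integral>z. poisson_kernel x z *\<^sub>R F z \<partial>sphere_measure) < 1"
        using t by (meson mult_left_le_one_le norm_ge_zero le_less_trans)
      then show "f x \<in> ball 0 1" using t by (simp add: f_def)
    qed
    show "harmonic_on (\<lambda>x. f x $ i) (ball 0 1)" for i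
      by (rule harmonic_on_transform[OF harmonic_on_poisson_integral(1)[OF Fm Fb]]) (simp add: fi)
  qed
  moreover have "(f has_derivative (*v) A) (at 0)"
  proof -
    have "((\<lambda>x. f x $ i) has_derivative (\<lambda>h. (A *v h) $ i)) (at 0)" for i
    proof -
      have "((\<lambda>x. f x $ i) has_derivative (\<lambda>h. DIM(real^'n) * (\<integral>z. (t * F z $ i) * (z \<bullet> h) \<partial>sphere_measure))) (at 0)"
        by (rule has_derivative_transform_within_open[OF harmonic_on_poisson_integral(2)[OF Fm Fb], of "ball 0 1"])
           (auto simp: fi)
      moreover have "DIM(real^'n) * (\<integral>z. (t * F z $ i) * (z \<bullet> h) \<partial>sphere_measure) = (A *v h) $ i" for h
      proof -
        \<comment> \<open>With \<open>h\<close> as row \<open>i\<close> and zeros elsewhere, the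
          extremal identity isolates component \<open>i\<close> of \<open>A *v h\<close>. The factor
          \<open>1 / n\<close> of the matrix inner product cancels the \<open>n\<close> from the
          derivative of the Poisson integral.\<close>
        define C :: "real^'n^'n" where "C = (\<chi> k. if k = i then h else 0)"
        have "F z \<bullet> (C *v z) = F z $ i * (z \<bullet> h)" for z
          unfolding inner_vec_def[of "F z"] C_def
          by (subst sum.remove[of _ i]) (auto simp: matrix_vector_mul_component inner_commute)
        moreover have "A \<bullet> C = (A *v h) $ i"
          unfolding inner_vec_def[of A] C_def
          by (subst sum.remove[of _ i]) (auto simp: matrix_vector_mul_component)
        ultimately show ?thesis using ext[of C] by (simp add: matrix_inner_eq F_def mult.assoc field_simps)
      qed
      ultimately show ?thesis by simp
    qed
    then have "(f has_derivative (\<lambda>h. A *v h)) (at 0)"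
      unfolding has_derivative_componentwise_within[of f] by (auto simp: Basis_vec_def inner_axis)
    then show ?thesis by simp
  qed
  moreover have "f 0 = 0"
  proof -
    have "f 0 = t *\<^sub>R (\<integral>z. F z \<partial>sphere_measure)"
      unfolding f_def by (intro arg_cong[where f="\<lambda>v. t *\<^sub>R v"] Bochner_Integration.integral_cong) (auto simp: poisson_kernel_0)
    moreover have "(\<integral>z. F z \<partial>sphere_measure) = 0"
      using F odd by (rule integral_sphere_odd)
    ultimately show ?thesis by simp
  qed
  ultimately show ?thesis using that by blast
qed

theorem theorem5p1:
  fixes A :: "real^'n^'n"
  shows "((\<exists>f. harmonic_self_map_ball f \<and> f 0 = 0 \<and> (f has_derivative ((*v) A)) (at 0)) \<longleftrightarrow>
          (\<exists>f. harmonic_self_map_ball f \<and> (f has_derivative ((*v) A)) (at 0))) \<and>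
         ((\<exists>f. harmonic_self_map_ball f \<and> (f has_derivative ((*v) A)) (at 0)) \<longleftrightarrow>
          hardy_dual_norm A \<le> 1)"
  by (metis hardy_dual_norm_le_1_if_harmonic harmonic_if_hardy_dual_norm_le_1)

end
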